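(* Let $\mu=e^{-V}dx$ be a probability distribution on $\mathbb{R}^d$ with $V\in\mathcal{C}^2(\mathbb{R}^d)$, and let $C_{Lip,Lip}\in(0,\infty]$ be as in the context. Then for all functions $f:\mathbb{R}^d\to\mathbb{R}_+$ (weakly differentiable) with $\int f\,d\mu=1$, \[ W_1(\mu,f\mu)\le C_{Lip,Lip}\int_{\mathbb{R}^d}|\nabla f|\,d\mu . \]
   Context: $\mathcal{L}f=\Delta f-\nabla V\cdot\nabla f$. $C_{Lip,Lip}$ is a constant such that for every Lipschitz function $g:\mathbb{R}^d\to\mathbb{R}$ there exists a Lipschitz function $f$ solving $\mathcal{L}f=g-\int g\,d\mu$ (weakly) with $\|\nabla f\|_\infty\le C_{Lip,Lip}\|\nabla g\|_\infty$; if no finite such constant exists, $C_{Lip,Lip}=\infty$ and the inequality is empty. $W_1(\alpha,\beta)=\sup\{\int h\,d\alpha-\int h\,d\beta : \|\nabla h\|_\infty\le1\}$ is the $L^1$-Kantorovich–Wasserstein distance. *)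

theory Defs
  imports "HOL-Analysis.Analysis" "HOL-Probability.Probability"
begin

fun dderiv :: "('a::euclidean_space \<Rightarrow> real) \<Rightarrow> 'a list \<Rightarrow> 'a \<Rightarrow> real" where
  "dderiv \<phi> [] = \<phi>"
| "dderiv \<phi> (v # vs) = (\<lambda>x. frechet_derivative (dderiv \<phi> vs) (at x) v)"

definition C_k :: "nat \<Rightarrow> ('a::euclidean_space \<Rightarrow> real) \<Rightarrow> bool" where
  "C_k k \<phi> \<longleftrightarrow> (\<forall>vs. length vs \<le> k \<longrightarrow>
      continuous_on UNIV (dderiv \<phi> vs) \<and>
      (length vs < k \<longrightarrow> (\<forall>x. dderiv \<phi> vs differentiable (at x))))"

definition smooth_fun :: "('a::euclidean_space \<Rightarrow> real) \<Rightarrow> bool" where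
  "smooth_fun \<phi> \<longleftrightarrow> (\<forall>k. C_k k \<phi>)"

definition test_fun :: "('a::euclidean_space \<Rightarrow> real) \<Rightarrow> bool" where
  "test_fun \<phi> \<longleftrightarrow> smooth_fun \<phi> \<and> bounded {x. \<phi> x \<noteq> 0}"

definition grad :: "('a::euclidean_space \<Rightarrow> real) \<Rightarrow> 'a \<Rightarrow> 'a" where
  "grad \<phi> x = (\<Sum>b\<in>Basis. dderiv \<phi> [b] x *\<^sub>R b)"

definition laplacian :: "('a::euclidean_space \<Rightarrow> real) \<Rightarrow> 'a \<Rightarrow> real" where
  "laplacian \<phi> x = (\<Sum>b\<in>Basis. dderiv \<phi> [b, b] x)"

definition Lgen :: "('a::euclidean_space \<Rightarrow> real) \<Rightarrow> ('a \<Rightarrow> real) \<Rightarrow> 'a \<Rightarrow> real" where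
  "Lgen V \<phi> x = laplacian \<phi> x - grad V x \<bullet> grad \<phi> x"

definition mu :: "('a::euclidean_space \<Rightarrow> real) \<Rightarrow> 'a measure" where
  "mu V = density lborel (\<lambda>x. ennreal (exp (- V x)))"

text \<open>Weak solution of L f = h: for every test function phi,
  int f (L phi) dmu = int h phi dmu  (L is symmetric in L^2(mu)).\<close>
definition weak_solution :: "('a::euclidean_space \<Rightarrow> real) \<Rightarrow> ('a \<Rightarrow> real) \<Rightarrow> ('a \<Rightarrow> real) \<Rightarrow> bool" where
  "weak_solution V f h \<longleftrightarrow> (\<forall>\<phi>. test_fun \<phi> \<longrightarrow>
      (\<integral>x. f x * Lgen V \<phi> x \<partial>mu V) = (\<integral>x. h x * \<phi> x \<partial>mu V))"

text \<open>C is an admissible Lip-Lip constant: every Lipschitz g (mu-integrable, so that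
  int g dmu makes sense) admits a Lipschitz weak solution f of L f = g - int g dmu with
  Lip(f) \<le> C Lip(g).\<close>
definition Lip_Lip_const :: "('a::euclidean_space \<Rightarrow> real) \<Rightarrow> real \<Rightarrow> bool" where
  "Lip_Lip_const V C \<longleftrightarrow> (\<forall>g L. L-lipschitz_on UNIV g \<and> integrable (mu V) g \<longrightarrow>
      (\<exists>f. (C * L)-lipschitz_on UNIV f \<and>
           weak_solution V f (\<lambda>x. g x - (\<integral>y. g y \<partial>mu V))))"

definition weak_grad :: "('a::euclidean_space \<Rightarrow> real) \<Rightarrow> ('a \<Rightarrow> 'a) \<Rightarrow> bool" where
  "weak_grad f G \<longleftrightarrow>
     (\<forall>K. compact K \<longrightarrow> set_integrable lborel K f \<and> set_integrable lborel K G) \<and>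
     (\<forall>\<phi>. test_fun \<phi> \<longrightarrow> (\<forall>b\<in>Basis.
        (\<integral>x. f x * dderiv \<phi> [b] x \<partial>lborel) = - (\<integral>x. (G x \<bullet> b) * \<phi> x \<partial>lborel)))"

definition W1 :: "'a::euclidean_space measure \<Rightarrow> 'a measure \<Rightarrow> ereal" where
  "W1 \<alpha> \<beta> = Sup {ereal ((\<integral>x. h x \<partial>\<alpha>) - (\<integral>x. h x \<partial>\<beta>)) | h.
      1-lipschitz_on UNIV h \<and> integrable \<alpha> h \<and> integrable \<beta> h}"

end

theory Submission
  imports Defs "HOL-Computational_Algebra.Polynomial"
begin

text \<open>Let \<open>h\<close> be 1-Lipschitz with mean \<open>m\<close> and let \<open>u\<close> be the \<open>C\<close>-Lipschitz weak solution of
  \<open>L u = h - m\<close>. Formally, the integral of \<open>(h - m) f\<close> is minus the integral of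
  \<open>grad u \<bullet> grad f\<close>, whence the bound. Neither factor is regular, so write \<open>P = exp (- V)\<close>, let
  \<open>f\<close> be cut off to compact support with weak gradient \<open>H\<close>, and test the equation for \<open>u\<close> with
  \<open>y \<mapsto> k (x - y)\<close> and the weak gradient of \<open>f\<close> with the kernel \<open>k (x - y)\<close> and its derivatives in
  \<open>x\<close>, for a smooth bump \<open>k\<close>. Fubini then
  turns the integral of \<open>f \<cdot> ((h - m) P * k)\<close> into that of
  \<open>\<integral> u(y) (D\<^sub>y [P(y) k(x - y)] H(x)) dy\<close> over \<open>x\<close>. As \<open>H(x)\<close> is a constant direction in the inner integral,
  difference quotients bound it by \<open>C |H(x)| (P * k)(x)\<close> without differentiating \<open>u\<close>. Only
  continuous functions are mollified, so shrinking \<open>k\<close> is a locally uniform limit.\<close>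

section \<open>Smooth functions and bumps\<close>

lemma dderiv_append: "dderiv \<phi> (vs @ ws) = dderiv (dderiv \<phi> ws) vs"
  by (induction vs) auto

lemma dderiv_eqI:
  assumes "\<And>x. (\<phi> has_derivative \<phi>' x) (at x)"
  shows "dderiv \<phi> [v] = (\<lambda>x. \<phi>' x v)"
  using frechet_derivative_at[OF assms] by (auto simp: fun_eq_iff)

lemma has_derivative_dderiv:
  assumes "\<phi> differentiable (at x)"
  shows "(\<phi> has_derivative (\<lambda>v. dderiv \<phi> [v] x)) (at x)"
  using assms by (simp add: frechet_derivative_works)

lemma C_k_0: "C_k 0 \<phi> \<longleftrightarrow> continuous_on UNIV \<phi>"
  by (auto simp: C_k_def)

text \<open>\<open>dderiv\<close> consumes its list from the right, so the last entry is the
  direction differentiated first. Splitting the list at its end therefore peels off one derivative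
  of \<open>\<phi>\<close> itself, and this recursion is what makes the closure properties below
  provable by induction on \<open>k\<close>.\<close>

lemma C_k_Suc:
  "C_k (Suc k) \<phi> \<longleftrightarrow> (\<forall>x. \<phi> differentiable (at x)) \<and> (\<forall>v. C_k k (dderiv \<phi> [v]))"
proof (intro iffI conjI allI)
  assume *: "C_k (Suc k) \<phi>"
  show "\<phi> differentiable (at x)" for x
    using *[unfolded C_k_def, rule_format, of "[]"] by simp
  show "C_k k (dderiv \<phi> [v])" for v
    unfolding C_k_def
  proof (intro allI impI)
    fix vs :: "'a list" assume "length vs \<le> k"
    then show "continuous_on UNIV (dderiv (dderiv \<phi> [v]) vs) \<and>
        (length vs < k \<longrightarrow> (\<forall>x. dderiv (dderiv \<phi> [v]) vs differentiable (at x)))"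
      using *[unfolded C_k_def, rule_format, of "vs @ [v]"] unfolding dderiv_append by simp
  qed
next
  assume *: "(\<forall>x. \<phi> differentiable (at x)) \<and> (\<forall>v. C_k k (dderiv \<phi> [v]))"
  show "C_k (Suc k) \<phi>"
    unfolding C_k_def
  proof (intro allI impI)
    fix vs :: "'a list" assume len: "length vs \<le> Suc k"
    show "continuous_on UNIV (dderiv \<phi> vs) \<and>
        (length vs < Suc k \<longrightarrow> (\<forall>x. dderiv \<phi> vs differentiable (at x)))"
    proof (cases vs rule: rev_exhaust)
      case Nil
      then show ?thesis
        using * by (auto intro!: differentiable_imp_continuous_on
            simp: differentiable_on_def differentiable_at_withinI)
    next
      case (snoc ws v)
      have "C_k k (dderiv \<phi> [v])" using * by blast
      with len snoc show ?thesis
        unfolding C_k_def snoc dderiv_append by simp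
    qed
  qed
qed

lemma C_k_mono: "C_k m \<phi> \<Longrightarrow> k \<le> m \<Longrightarrow> C_k k \<phi>"
  by (force simp: C_k_def)

lemma C_k_SucI:
  assumes "\<And>x. (\<phi> has_derivative \<phi>' x) (at x)" "\<And>v. C_k k (\<lambda>x. \<phi>' x v)"
  shows "C_k (Suc k) \<phi>"
  unfolding C_k_Suc dderiv_eqI[OF assms(1)]
  using assms differentiable_def by blast

lemma C_k_const: "C_k k (\<lambda>x. c)"
proof (induction k arbitrary: c)
  case (Suc k)
  show ?case by (rule C_k_SucI[where \<phi>' = "\<lambda>x v. 0"]) (use Suc in auto)
qed (simp add: C_k_0)

lemma C_k_add: "C_k k f \<Longrightarrow> C_k k g \<Longrightarrow> C_k k (\<lambda>x. f x + g x)"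
proof (induction k arbitrary: f g)
  case (Suc k)
  then have d: "\<And>x. f differentiable (at x)" "\<And>x. g differentiable (at x)"
    and c: "\<And>v. C_k k (dderiv f [v])" "\<And>v. C_k k (dderiv g [v])"
    by (auto simp only: C_k_Suc)
  show ?case
    by (rule C_k_SucI, rule has_derivative_add[OF has_derivative_dderiv[OF d(1)] has_derivative_dderiv[OF d(2)]])
       (rule Suc.IH[OF c])
qed (auto simp: C_k_0 intro: continuous_intros)

lemma C_k_mult: "C_k k f \<Longrightarrow> C_k k g \<Longrightarrow> C_k k (\<lambda>x. f x * g x)"
proof (induction k arbitrary: f g)
  case (Suc k)
  then have d: "\<And>x. f differentiable (at x)" "\<And>x. g differentiable (at x)"
    and c: "\<And>v. C_k k (dderiv f [v])" "\<And>v. C_k k (dderiv g [v])"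
    by (auto simp only: C_k_Suc)
  \<comment> \<open>The product rule leaves one factor undifferentiated in each term, so the
    induction hypothesis also has to be fed \<open>f\<close> and \<open>g\<close> themselves at
    order \<open>k\<close>.\<close>
  have fg: "C_k k f" "C_k k g" using Suc.prems by (auto elim: C_k_mono)
  show ?case
    by (rule C_k_SucI, rule has_derivative_mult[OF has_derivative_dderiv[OF d(1)] has_derivative_dderiv[OF d(2)]])
       (intro C_k_add Suc.IH c fg)
qed (auto simp: C_k_0 intro: continuous_intros)

lemma C_k_inner: "C_k k (\<lambda>x. (x - a) \<bullet> v)"
proof (cases k)
  case (Suc k)
  show ?thesis unfolding Suc
    by (rule C_k_SucI[where \<phi>' = "\<lambda>x w. w \<bullet> v"]) (auto intro!: derivative_eq_intros C_k_const)
qed (auto simp: C_k_0 intro!: continuous_intros)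

lemma C_k_quadratic: "C_k k (\<lambda>x. \<alpha> - \<gamma> * ((x - a) \<bullet> (x - a)))"
proof (cases k)
  case (Suc k)
  show ?thesis unfolding Suc
  proof (rule C_k_SucI)
    show "((\<lambda>x. \<alpha> - \<gamma> * ((x - a) \<bullet> (x - a))) has_derivative (\<lambda>v. (- 2 * \<gamma>) * ((x - a) \<bullet> v))) (at x)" for x
      by (auto intro!: derivative_eq_intros simp: inner_commute algebra_simps)
  qed (rule C_k_mult[OF C_k_const C_k_inner])
qed (auto simp: C_k_0 intro!: continuous_intros)

text \<open>This family is closed under differentiation, so all of its members are smooth.\<close>

definition flat_exp :: "real poly \<Rightarrow> real \<Rightarrow> real" where
  "flat_exp p t = (if t > 0 then poly p (1 / t) * exp (- (1 / t)) else 0)"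

text \<open>With \<open>s = 1 / t\<close>, the chain rule turns the derivative of
  \<open>p(s) exp(-s)\<close> in \<open>t\<close> into \<open>s^2 (p(s) - p'(s)) exp(-s)\<close>;
  the polynomial \<open>[:0, 0, 1:]\<close> is \<open>s^2\<close>.\<close>

definition flat_exp_deriv :: "real poly \<Rightarrow> real poly" where
  "flat_exp_deriv p = [:0, 0, 1:] * (p - pderiv p)"

lemma flat_exp_nonpos: "t \<le> 0 \<Longrightarrow> flat_exp p t = 0"
  by (simp add: flat_exp_def)

lemma poly_mult_exp_minus_tendsto_0: "((\<lambda>x::real. poly p x * exp (- x)) \<longlongrightarrow> 0) at_top"
proof -
  have "((\<lambda>x::real. \<Sum>i\<le>degree p. coeff p i * (x ^ i / exp x)) \<longlongrightarrow> (\<Sum>i\<le>degree p. coeff p i * 0)) at_top"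
    by (intro tendsto_intros tendsto_power_div_exp_0)
  then show ?thesis
    by (simp add: poly_altdef sum_divide_distrib exp_minus divide_inverse sum_distrib_right mult.assoc)
qed

lemma flat_exp_tendsto_0: "((\<lambda>t. flat_exp p t) \<longlongrightarrow> 0) (at 0)"
proof -
  have "((\<lambda>t. poly p (inverse t) * exp (- inverse t)) \<longlongrightarrow> 0) (at_right 0)"
    by (rule filterlim_compose[OF poly_mult_exp_minus_tendsto_0 filterlim_inverse_at_top_right])
  then have "((\<lambda>t. flat_exp p t) \<longlongrightarrow> 0) (at_right 0)"
    by (rule Lim_transform_eventually)
       (auto simp: eventually_at_filter flat_exp_def field_simps)
  moreover have "((\<lambda>t. flat_exp p t) \<longlongrightarrow> 0) (at_left 0)"
    by (rule Lim_transform_eventually[OF tendsto_const])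
       (auto simp: eventually_at_filter flat_exp_def)
  ultimately show ?thesis
    by (simp add: filterlim_at_split)
qed

lemma flat_exp_has_real_derivative: "(flat_exp p has_real_derivative flat_exp (flat_exp_deriv p) t) (at t)"
proof -
  consider "t > 0" | "t < 0" | "t = 0" by linarith
  then show ?thesis
  proof cases
    case 1
    have "((\<lambda>t. poly p (1 / t) * exp (- (1 / t))) has_real_derivative flat_exp (flat_exp_deriv p) t) (at t)"
      using 1 by (auto intro!: derivative_eq_intros DERIV_chain'[OF _ poly_DERIV]
          simp: flat_exp_def flat_exp_deriv_def field_simps power2_eq_square)
    moreover have "eventually (\<lambda>s. s > 0) (nhds t)"
      using 1 by (intro eventually_nhds_in_open[of "{0<..}", simplified] open_greaterThan)
    ultimately show ?thesis
      by (subst DERIV_cong_ev[OF refl _ refl, where g = "\<lambda>t. poly p (1 / t) * exp (- (1 / t))"])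
         (auto simp: flat_exp_def elim: eventually_mono)
  next
    case 2
    then have "eventually (\<lambda>s. s < 0) (nhds t)"
      by (intro eventually_nhds_in_open[of "{..<0}", simplified] open_lessThan)
    then show ?thesis using 2
      by (subst DERIV_cong_ev[OF refl _ refl, where g = "\<lambda>t. 0"])
         (auto simp: flat_exp_def elim: eventually_mono)
  next
    case 3
    \<comment> \<open>Dividing by \<open>h\<close> multiplies the polynomial by its variable
      \<open>1 / h\<close>, so the difference quotient at 0 is again a member of the family and
      tends to 0.\<close>
    have "flat_exp p h / h = flat_exp (pCons 0 p) h" for h
      by (simp add: flat_exp_def)
    then show ?thesis
      unfolding 3 DERIV_def using flat_exp_tendsto_0[of "pCons 0 p"]
      by (simp add: flat_exp_nonpos)
  qed
qed

lemma flat_exp_continuous: "continuous_on A (flat_exp p)"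
  using flat_exp_has_real_derivative DERIV_isCont continuous_at_imp_continuous_on by blast

text \<open>Needed for the gradients of the cutoffs, where the argument is 1 minus a nonnegative
  quantity. On the negative axis the function vanishes, so compactness of \<open>{0..1}\<close>
  suffices.\<close>

lemma flat_exp_bounded:
  obtains M where "M \<ge> 0" "\<And>t. t \<le> 1 \<Longrightarrow> \<bar>flat_exp p t\<bar> \<le> M"
proof -
  have "bounded (flat_exp p ` {0..1})"
    by (intro compact_imp_bounded compact_continuous_image flat_exp_continuous compact_Icc)
  then obtain M where M: "\<And>t. t \<in> {0..1} \<Longrightarrow> \<bar>flat_exp p t\<bar> \<le> M"
    unfolding bounded_iff by force
  show ?thesis
  proof (rule that)
    show "0 \<le> M" using M[of 0] by simp
    then show "\<bar>flat_exp p t\<bar> \<le> M" if "t \<le> 1" for t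
      using M[of t] that by (cases "t \<le> 0") (auto simp: flat_exp_nonpos)
  qed
qed

lemma flat_exp_compose_has_derivative:
  assumes "(q has_derivative q') (at x)"
  shows "((\<lambda>x. flat_exp p (q x)) has_derivative (\<lambda>v. flat_exp (flat_exp_deriv p) (q x) * q' v)) (at x)"
  using has_derivative_compose[OF assms flat_exp_has_real_derivative[unfolded has_field_derivative_def]]
  by simp

text \<open>Differentiating replaces \<open>p\<close> by \<open>flat_exp_deriv p\<close>, so the
  induction has to run over all polynomials at once.\<close>

lemma C_k_flat_exp_compose:
  assumes "smooth_fun q"
  shows "C_k k (\<lambda>x. flat_exp p (q x))"
proof (induction k arbitrary: p)
  case 0
  have "continuous_on UNIV q" using assms by (simp add: smooth_fun_def flip: C_k_0)
  then show ?case
    by (auto simp: C_k_0 intro: continuous_on_compose2[OF flat_exp_continuous])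
next
  case (Suc k)
  have "C_k (Suc k) q" using assms by (simp add: smooth_fun_def)
  then have d: "q differentiable (at x)" and c: "C_k k (dderiv q [v])" for x v
    by (auto simp only: C_k_Suc)
  show ?case
    by (rule C_k_SucI, rule flat_exp_compose_has_derivative[OF has_derivative_dderiv[OF d]])
       (rule C_k_mult[OF Suc.IH c])
qed

text \<open>Using the squared distance keeps the function smooth at the centre. Two parametrisations
  occur, both vanishing at distance at least \<open>r\<close> from \<open>a\<close>:
  \<open>r\<^sup>2\<close> and 1 for the mollifier, 1 and \<open>1 / r\<^sup>2\<close> for the
  cutoff. The polynomial is kept as a parameter so that derivatives are expressible by bumps
  again.\<close>

definition bump :: "real poly \<Rightarrow> real \<Rightarrow> real \<Rightarrow> 'a::euclidean_space \<Rightarrow> 'a \<Rightarrow> real" where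
  "bump p \<alpha> \<gamma> a x = flat_exp p (\<alpha> - \<gamma> * ((x - a) \<bullet> (x - a)))"

lemma bump_has_derivative:
  "(bump p \<alpha> \<gamma> a has_derivative
     (\<lambda>v. bump (flat_exp_deriv p) \<alpha> \<gamma> a x * (- 2 * \<gamma> * ((x - a) \<bullet> v)))) (at x)"
  unfolding bump_def
  by (rule flat_exp_compose_has_derivative)
     (auto intro!: derivative_eq_intros simp: inner_commute algebra_simps)

lemma smooth_fun_mult: "smooth_fun f \<Longrightarrow> smooth_fun g \<Longrightarrow> smooth_fun (\<lambda>x. f x * g x)"
  by (simp add: smooth_fun_def C_k_mult)

lemma smooth_fun_const: "smooth_fun (\<lambda>x. c)"
  by (simp add: smooth_fun_def C_k_const)

lemma smooth_fun_inner: "smooth_fun (\<lambda>x. (x - a) \<bullet> v)"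
  by (simp add: smooth_fun_def C_k_inner)

lemma smooth_fun_bump: "smooth_fun (bump p \<alpha> \<gamma> a)"
  unfolding smooth_fun_def bump_def
  by (intro allI C_k_flat_exp_compose) (simp add: smooth_fun_def C_k_quadratic)

lemma bump_continuous: "continuous_on A (\<lambda>x. bump p \<alpha> \<gamma> a x)"
  unfolding bump_def by (intro continuous_on_compose2[OF flat_exp_continuous[of UNIV]] continuous_intros) auto

lemma bump_eq_0:
  assumes "r > 0" "norm (x - a) \<ge> r"
  shows "bump p (r\<^sup>2) 1 a x = 0" "bump p 1 (1 / r\<^sup>2) a x = 0"
proof -
  have "r\<^sup>2 \<le> (x - a) \<bullet> (x - a)"
    using assms by (metis power2_norm_eq_inner power_mono less_imp_le)
  then show "bump p (r\<^sup>2) 1 a x = 0" "bump p 1 (1 / r\<^sup>2) a x = 0"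
    using assms by (auto simp: bump_def flat_exp_nonpos)
qed

section \<open>Compactly supported integrands\<close>

lemma integrable_continuous_compact_support:
  fixes c :: "'a::euclidean_space \<Rightarrow> real"
  assumes "continuous_on UNIV c" "\<And>x. norm (x - a) > r \<Longrightarrow> c x = 0"
  shows "integrable lborel c"
proof -
  have "integrable lborel (\<lambda>x. indicator (cball a r) x *\<^sub>R c x)"
    using assms(1) by (intro borel_integrable_compact) (auto intro: continuous_on_subset)
  also have "(\<lambda>x. indicator (cball a r) x *\<^sub>R c x) = c"
    using assms(2) by (force simp: indicator_def dist_norm norm_minus_commute)
  finally show ?thesis .
qed

lemma bounded_continuous_compact_support:
  fixes c :: "'a::euclidean_space \<Rightarrow> real"
  assumes "continuous_on UNIV c" "\<And>x. norm (x - a) > r \<Longrightarrow> c x = 0"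
  obtains M where "M \<ge> 0" "\<And>x. \<bar>c x\<bar> \<le> M"
proof -
  have "bounded (c ` cball a r)"
    using assms(1) by (intro compact_imp_bounded compact_continuous_image) (auto intro: continuous_on_subset)
  then obtain M where M: "\<And>x. x \<in> cball a r \<Longrightarrow> \<bar>c x\<bar> \<le> M"
    unfolding bounded_iff by force
  have "\<bar>c x\<bar> \<le> max M 0" for x
    using M[of x] assms(2)[of x]
    by (cases "norm (x - a) > r") (auto simp: dist_norm norm_minus_commute)
  then show ?thesis
    by (intro that[of "max M 0"]) auto
qed

lemma integral_abs_le:
  fixes f g :: "'a \<Rightarrow> real"
  assumes "integrable M f" "integrable M g" "\<And>x. \<bar>f x\<bar> \<le> g x"
  shows "\<bar>integral\<^sup>L M f\<bar> \<le> integral\<^sup>L M g"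
  by (rule integral_abs_bound[THEN order_trans], rule integral_mono) (use assms in auto)

text \<open>The factor \<open>c\<close> confines the product to a ball, where \<open>f\<close> is
  integrable, and is itself bounded there.\<close>

lemma integrable_mult_continuous_compact_support:
  fixes f :: "'a::euclidean_space \<Rightarrow> 'b::euclidean_space" and c :: "'a \<Rightarrow> real"
  assumes f: "\<And>K. compact K \<Longrightarrow> set_integrable lborel K f"
    and c: "continuous_on UNIV c" "\<And>x. norm x > r \<Longrightarrow> c x = 0"
  shows "integrable lborel (\<lambda>x. c x *\<^sub>R f x)"
proof -
  obtain M where M: "M \<ge> 0" "\<And>x. \<bar>c x\<bar> \<le> M"
    using bounded_continuous_compact_support[where c = c and a = 0 and r = r] c by auto
  have *: "integrable lborel (\<lambda>x. indicator (cball 0 r) x *\<^sub>R f x)"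
    using f[of "cball 0 r"] by (simp add: set_integrable_def)
  have [measurable]: "c \<in> borel_measurable borel"
    using c by (intro borel_measurable_continuous_onI)
  have "integrable lborel (\<lambda>x. c x *\<^sub>R (indicator (cball 0 r) x *\<^sub>R f x))"
  proof (rule Bochner_Integration.integrable_bound)
    show "integrable lborel (\<lambda>x. M *\<^sub>R (indicator (cball 0 r) x *\<^sub>R f x))"
      using * by (rule integrable_scaleR_right)
    show "(\<lambda>x. c x *\<^sub>R (indicator (cball 0 r) x *\<^sub>R f x)) \<in> borel_measurable lborel"
      using borel_measurable_integrable[OF *] by measurable
    show "AE x in lborel. norm (c x *\<^sub>R (indicator (cball 0 r) x *\<^sub>R f x))
        \<le> norm (M *\<^sub>R (indicator (cball 0 r) x *\<^sub>R f x))"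
      using M by (intro AE_I2) (auto simp: abs_mult intro!: mult_right_mono)
  qed
  also have "(\<lambda>x. c x *\<^sub>R (indicator (cball 0 r) x *\<^sub>R f x)) = (\<lambda>x. c x *\<^sub>R f x)"
    using c(2) by (force simp: indicator_def)
  finally show ?thesis .
qed

text \<open>Where both \<open>a x\<close> and \<open>k (x - y)\<close> are nonzero,
  \<open>norm y\<close> is at most \<open>R + r\<close>. Hence \<open>c\<close> may be replaced by
  its restriction \<open>d\<close> to that ball, which is integrable, and the integrand is dominated
  by a constant times the tensor product of \<open>a\<close> and \<open>d\<close>.\<close>

lemma integrable_convolution_pair:
  fixes a c k :: "'a::euclidean_space \<Rightarrow> real"
  assumes a: "integrable lborel a" "\<And>x. norm x > R \<Longrightarrow> a x = 0"
    and c: "continuous_on UNIV c"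
    and k: "continuous_on UNIV k" "\<And>z. norm z > r \<Longrightarrow> k z = 0"
  shows "integrable (lborel \<Otimes>\<^sub>M lborel) (\<lambda>(x, y). a x * (c y * k (x - y)))"
proof -
  obtain M where M: "M \<ge> 0" "\<And>x. \<bar>k x\<bar> \<le> M"
    using bounded_continuous_compact_support[where c = k and a = 0 and r = r] k by auto
  define d where "d y = indicator (cball 0 (R + r)) y *\<^sub>R c y" for y
  have d: "integrable lborel d"
    unfolding d_def using c by (intro borel_integrable_compact) (auto intro: continuous_on_subset)
  have [measurable]: "a \<in> borel_measurable borel" "d \<in> borel_measurable borel" "k \<in> borel_measurable borel"
    using borel_measurable_integrable[OF a(1)] borel_measurable_integrable[OF d] k
    by (auto intro: borel_measurable_continuous_onI)
  have "integrable (lborel \<Otimes>\<^sub>M lborel) (\<lambda>(x, y). a x * d y)"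
    using a(1) d by (intro lborel_pair.Fubini_integrable) (auto simp: abs_mult)
  then have "integrable (lborel \<Otimes>\<^sub>M lborel) (\<lambda>z. M * (case z of (x, y) \<Rightarrow> a x * d y))"
    by (rule integrable_mult_right)
  then have "integrable (lborel \<Otimes>\<^sub>M lborel) (\<lambda>(x, y). a x * d y * k (x - y))"
  proof (rule Bochner_Integration.integrable_bound)
    show "AE z in lborel \<Otimes>\<^sub>M lborel. norm (case z of (x, y) \<Rightarrow> a x * d y * k (x - y))
        \<le> norm (M * (case z of (x, y) \<Rightarrow> a x * d y))"
      using M by (intro AE_I2) (auto simp: abs_mult mult.commute[of M] intro!: mult_left_mono)
  qed simp
  moreover have "a x * d y * k (x - y) = a x * (c y * k (x - y))" for x y
  proof -
    have "norm y \<le> R + r" if "a x \<noteq> 0" "k (x - y) \<noteq> 0"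
      using that a(2)[of x] k(2)[of "x - y"] norm_triangle_ineq4[of x "x - y"] by fastforce
    then show ?thesis
      by (auto simp: d_def indicator_def)
  qed
  ultimately show ?thesis by simp
qed

text \<open>This exchange lets a rough but compactly supported \<open>a\<close> be paired with a
  mollified continuous function, or be mollified itself and paired with the continuous function,
  whichever side the next derivative has to act on.\<close>

lemma convolution_Fubini:
  fixes a c k :: "'a::euclidean_space \<Rightarrow> real"
  assumes "integrable lborel a" "\<And>x. norm x > R \<Longrightarrow> a x = 0"
    and "continuous_on UNIV c"
    and "continuous_on UNIV k" "\<And>z. norm z > r \<Longrightarrow> k z = 0"
  shows "integrable lborel (\<lambda>x. a x * (\<integral>y. c y * k (x - y) \<partial>lborel))"
    and "integrable lborel (\<lambda>y. c y * (\<integral>x. a x * k (x - y) \<partial>lborel))"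
    and "(\<integral>x. a x * (\<integral>y. c y * k (x - y) \<partial>lborel) \<partial>lborel) =
         (\<integral>y. c y * (\<integral>x. a x * k (x - y) \<partial>lborel) \<partial>lborel)"
proof -
  have int: "integrable (lborel \<Otimes>\<^sub>M lborel) (\<lambda>(x, y). a x * (c y * k (x - y)))"
    using assms by (rule integrable_convolution_pair)
  have *: "(\<integral>x. a x * (c y * k (x - y)) \<partial>lborel) = c y * (\<integral>x. a x * k (x - y) \<partial>lborel)" for y
    by (simp add: mult.left_commute[of _ "c y"])
  show "integrable lborel (\<lambda>x. a x * (\<integral>y. c y * k (x - y) \<partial>lborel))"
    using lborel_pair.integrable_fst[OF int] by simp
  show "integrable lborel (\<lambda>y. c y * (\<integral>x. a x * k (x - y) \<partial>lborel))"
    using lborel_pair.integrable_snd[OF int] by (simp add: *)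
  show "(\<integral>x. a x * (\<integral>y. c y * k (x - y) \<partial>lborel) \<partial>lborel) =
         (\<integral>y. c y * (\<integral>x. a x * k (x - y) \<partial>lborel) \<partial>lborel)"
    using lborel_pair.Fubini_integral[OF int] by (simp add: *)
qed

lemma lborel_integral_translation:
  fixes F :: "'a::euclidean_space \<Rightarrow> real"
  assumes [measurable]: "F \<in> borel_measurable borel"
  shows "(\<integral>x. F (c + x) \<partial>lborel) = (\<integral>x. F x \<partial>lborel)"
  by (subst (2) lborel_distr_plus[of c, symmetric]) (simp add: integral_distr)

text \<open>For a fixed direction, difference quotients can be moved from \<open>k\<close> to \<open>u\<close>; thus no
  differentiability of the Lipschitz function \<open>u\<close> is needed.\<close>

lemma lipschitz_integral_derivative_le:
  fixes u k :: "'a::euclidean_space \<Rightarrow> real"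
  assumes u: "L-lipschitz_on UNIV u"
    and k: "\<And>x. (k has_derivative k' x) (at x)" "continuous_on UNIV (\<lambda>x. k' x v)"
    and supp: "\<And>x. norm (x - a) > r \<Longrightarrow> k x = 0"
  shows "\<bar>\<integral>x. u x * k' x v \<partial>lborel\<bar> \<le> L * norm v * (\<integral>x. \<bar>k x\<bar> \<partial>lborel)"
proof -
  define e :: "nat \<Rightarrow> real" where "e n = inverse (real (Suc n))" for n
  have e: "0 < e n" "e n \<le> 1" for n
    by (auto simp: e_def divide_simps)
  define Q where "Q n x = (k (x + e n *\<^sub>R v) - k x) / e n" for n x
  have kc: "continuous_on UNIV k"
    using k(1) by (meson differentiableI differentiable_imp_continuous_on differentiable_at_withinI differentiable_on_def)
  have uc: "continuous_on UNIV u"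
    using u by (rule lipschitz_on_continuous_on)
  have [measurable]: "k \<in> borel_measurable borel" "u \<in> borel_measurable borel"
      "(\<lambda>x. k' x v) \<in> borel_measurable borel"
    using kc uc k(2) by (auto intro: borel_measurable_continuous_onI)
  have D: "((\<lambda>t. k (x + t *\<^sub>R v)) has_real_derivative k' (x + t *\<^sub>R v) v) (at t)" for x t
  proof -
    have "((\<lambda>t. k (x + t *\<^sub>R v)) has_derivative (\<lambda>s. k' (x + t *\<^sub>R v) (s *\<^sub>R v))) (at t)"
      by (rule has_derivative_compose[OF _ k(1)]) (auto intro!: derivative_eq_intros)
    also have "(\<lambda>s. k' (x + t *\<^sub>R v) (s *\<^sub>R v)) = (*) (k' (x + t *\<^sub>R v) v)"
      using linear_scale[OF has_derivative_linear[OF k(1)]] by (auto simp: fun_eq_iff)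
    finally show ?thesis by (simp add: has_field_derivative_def)
  qed
  have lim: "(\<lambda>n. Q n x) \<longlonglongrightarrow> k' x v" for x
  proof -
    have "(\<lambda>t. (k (x + t *\<^sub>R v) - k x) / t) \<midarrow>0\<rightarrow> k' x v"
      using D[of x 0] by (simp add: DERIV_def)
    moreover have "e \<longlonglongrightarrow> 0"
      unfolding e_def by (rule LIMSEQ_inverse_real_of_nat)
    ultimately show ?thesis
      using e(1) unfolding Q_def LIMSEQ_SEQ_conv[symmetric] by (metis less_irrefl)
  qed
  \<comment> \<open>The quotients \<open>Q n\<close> vanish outside the ball of radius
    \<open>r + norm v\<close>. The intermediate point supplied by the mean value theorem may lie a
    further \<open>norm v\<close> away, whence the factor 2.\<close>
  have "bounded ((\<lambda>x. k' x v) ` cball a (r + 2 * norm v))"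
    using k(2) by (intro compact_imp_bounded compact_continuous_image) (auto intro: continuous_on_subset)
  then obtain M where M: "\<And>x. x \<in> cball a (r + 2 * norm v) \<Longrightarrow> \<bar>k' x v\<bar> \<le> M"
    unfolding bounded_iff by force
  have Q_bound: "\<bar>Q n x\<bar> \<le> indicator (cball a (r + norm v)) x * M" for n x
  proof (cases "x \<in> cball a (r + norm v)")
    case True
    obtain t where t: "0 < t" "t < e n" "k (x + e n *\<^sub>R v) - k (x + 0 *\<^sub>R v) = (e n - 0) * k' (x + t *\<^sub>R v) v"
      using MVT2[OF e(1)[of n], of "\<lambda>t. k (x + t *\<^sub>R v)" "\<lambda>t. k' (x + t *\<^sub>R v) v"] D by blast
    have "norm (x + t *\<^sub>R v - a) \<le> norm (x - a) + norm (t *\<^sub>R v)"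
      using norm_triangle_ineq[of "x - a" "t *\<^sub>R v"] by (simp add: algebra_simps)
    moreover have "norm (t *\<^sub>R v) \<le> norm v"
      using t e[of n] by (simp add: mult_left_le_one_le)
    ultimately have "\<bar>k' (x + t *\<^sub>R v) v\<bar> \<le> M"
      using True by (intro M) (auto simp: dist_norm norm_minus_commute)
    then show ?thesis
      using True t e[of n] by (simp add: Q_def)
  next
    case False
    then have 1: "norm (x - a) > r + norm v" by (simp add: dist_norm norm_minus_commute)
    have "norm (x - a) \<le> norm (x + e n *\<^sub>R v - a) + norm (e n *\<^sub>R v)"
      using norm_triangle_ineq4[of "x + e n *\<^sub>R v - a" "e n *\<^sub>R v"] by (simp add: algebra_simps)
    moreover have "norm (e n *\<^sub>R v) \<le> norm v"
      using e[of n] by (simp add: mult_left_le_one_le)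
    ultimately have "norm (x + e n *\<^sub>R v - a) > r" using 1 by linarith
    moreover have "norm (x - a) > r" using 1 norm_ge_zero[of v] by linarith
    ultimately show ?thesis
      using supp False by (simp add: Q_def)
  qed
  have kint: "integrable lborel (\<lambda>x. \<bar>k x\<bar>)"
    using kc supp by (intro integrable_continuous_compact_support[where a = a and r = r]) (auto intro!: continuous_intros)
  have "(\<lambda>n. \<integral>x. u x * Q n x \<partial>lborel) \<longlonglongrightarrow> (\<integral>x. u x * k' x v \<partial>lborel)"
  proof (rule integral_dominated_convergence[where w = "\<lambda>x. indicator (cball a (r + norm v)) x *\<^sub>R (\<bar>u x\<bar> * M)"])
    show "integrable lborel (\<lambda>x. indicator (cball a (r + norm v)) x *\<^sub>R (\<bar>u x\<bar> * M))"
      using uc by (intro borel_integrable_compact) (auto intro!: continuous_intros intro: continuous_on_subset)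
    show "AE x in lborel. norm (u x * Q n x) \<le> indicator (cball a (r + norm v)) x *\<^sub>R (\<bar>u x\<bar> * M)" for n
      using mult_left_mono[OF Q_bound abs_ge_zero] by (auto simp: abs_mult algebra_simps)
    show "AE x in lborel. (\<lambda>n. u x * Q n x) \<longlonglongrightarrow> u x * k' x v"
      using lim by (auto intro!: tendsto_intros)
  qed (unfold Q_def, measurable)
  moreover have "\<bar>\<integral>x. u x * Q n x \<partial>lborel\<bar> \<le> L * norm v * (\<integral>x. \<bar>k x\<bar> \<partial>lborel)" for n
  proof -
    define s where "s = e n *\<^sub>R v"
    have 1: "integrable lborel (\<lambda>x. u x * k x)"
      using kc uc supp by (intro integrable_continuous_compact_support[where a = a and r = r]) (auto intro!: continuous_intros)
    have 2: "integrable lborel (\<lambda>x. u (x - s) * k x)"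
      using kc uc supp by (intro integrable_continuous_compact_support[where a = a and r = r])
        (auto intro!: continuous_intros continuous_on_compose2[OF uc])
    have 3: "integrable lborel (\<lambda>x. u x * k (s + x))"
    proof (intro integrable_continuous_compact_support[where a = "a - s" and r = r])
      show "u x * k (s + x) = 0" if "r < norm (x - (a - s))" for x
        using supp[of "s + x"] that by (simp add: algebra_simps)
    qed (auto intro!: continuous_intros uc continuous_on_compose2[OF kc])
    have "(\<integral>x. u x * Q n x \<partial>lborel) = (\<integral>x. (u x * k (s + x) - u x * k x) / e n \<partial>lborel)"
      by (intro Bochner_Integration.integral_cong) (auto simp: Q_def s_def algebra_simps)
    also have "\<dots> = ((\<integral>x. u x * k (s + x) \<partial>lborel) - (\<integral>x. u x * k x \<partial>lborel)) / e n"
      using 1 3 by simp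
    \<comment> \<open>Translation invariance moves the shift from \<open>k\<close> to
      \<open>u\<close>. The Lipschitz bound then yields a factor
      \<open>norm s = e n * norm v\<close>, and its \<open>e n\<close> cancels the denominator of
      the quotient.\<close>
    also have "(\<integral>x. u x * k (s + x) \<partial>lborel) = (\<integral>x. u (x - s) * k x \<partial>lborel)"
      using lborel_integral_translation[of "\<lambda>x. u (x - s) * k x" s] by simp
    also have "(\<integral>x. u (x - s) * k x \<partial>lborel) - (\<integral>x. u x * k x \<partial>lborel) = (\<integral>x. (u (x - s) - u x) * k x \<partial>lborel)"
      using 1 2 by (simp add: left_diff_distrib)
    finally have eq: "(\<integral>x. u x * Q n x \<partial>lborel) = (\<integral>x. (u (x - s) - u x) * k x \<partial>lborel) / e n" .
    have "\<bar>\<integral>x. (u (x - s) - u x) * k x \<partial>lborel\<bar> \<le> (\<integral>x. L * norm s * \<bar>k x\<bar> \<partial>lborel)"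
    proof (rule integral_abs_bound[THEN order_trans], rule integral_mono)
      show "\<bar>(u (x - s) - u x) * k x\<bar> \<le> L * norm s * \<bar>k x\<bar>" for x
        using lipschitz_onD[OF u, of "x - s" x] by (auto simp: dist_norm abs_mult intro!: mult_right_mono)
    qed (use 1 2 kint in \<open>auto simp: left_diff_distrib\<close>)
    also have "\<dots> = e n * (L * norm v * (\<integral>x. \<bar>k x\<bar> \<partial>lborel))"
      using e(1)[of n] by (simp add: s_def)
    finally show ?thesis
      using e(1)[of n] by (simp add: eq field_simps)
  qed
  ultimately show ?thesis
    by (intro LIMSEQ_le_const2[OF tendsto_rabs]) auto
qed

section \<open>Test functions and weak gradients\<close>

lemma smooth_fun_dderiv:
  assumes "smooth_fun \<phi>"
  shows "continuous_on A (dderiv \<phi> vs)" "dderiv \<phi> vs differentiable (at x)"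
  using assms[unfolded smooth_fun_def C_k_def, rule_format, of vs "length vs"]
    assms[unfolded smooth_fun_def C_k_def, rule_format, of vs "Suc (length vs)"]
  by (auto intro: continuous_on_subset)

lemma test_fun_support:
  assumes "test_fun \<phi>"
  obtains r where "\<And>x. norm x > r \<Longrightarrow> \<phi> x = 0" "\<And>x v. norm x > r \<Longrightarrow> dderiv \<phi> [v] x = 0"
proof -
  have "bounded {x. \<phi> x \<noteq> 0}" using assms by (simp add: test_fun_def)
  then obtain r where "\<forall>x\<in>{x. \<phi> x \<noteq> 0}. norm x \<le> r"
    unfolding bounded_iff by blast
  then have r: "\<phi> x = 0" if "norm x > r" for x
    using that by force
  show ?thesis
  proof (rule that[of r])
    fix x v :: 'a assume "norm x > r"
    \<comment> \<open>Because this region is open, \<open>\<phi>\<close> vanishes near each of its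
      points, so the same radius serves for the derivatives.\<close>
    moreover have "open {x::'a. norm x > r}"
      by (intro open_Collect_less continuous_intros)
    ultimately have "(\<phi> has_derivative (\<lambda>v. 0)) (at x)"
      using r by (intro has_derivative_transform_within_open[OF has_derivative_const[of 0]]) auto
    then show "dderiv \<phi> [v] x = 0"
      by (simp flip: frechet_derivative_at)
  qed (use r in auto)
qed

lemma test_fun_mult:
  assumes "test_fun \<eta>" "smooth_fun \<phi>"
  shows "test_fun (\<lambda>x. \<eta> x * \<phi> x)"
  using assms unfolding test_fun_def
  by (auto intro: smooth_fun_mult elim: bounded_subset)

lemma grad_inner_Basis: "b \<in> Basis \<Longrightarrow> grad \<phi> x \<bullet> b = dderiv \<phi> [b] x"
  by (simp add: grad_def inner_sum_left_Basis)

lemma grad_inner: "grad \<phi> x \<bullet> grad \<psi> x = (\<Sum>b\<in>Basis. dderiv \<phi> [b] x * dderiv \<psi> [b] x)"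
  by (subst euclidean_inner) (simp add: grad_inner_Basis)

lemma grad_continuous: "smooth_fun \<phi> \<Longrightarrow> continuous_on A (grad \<phi>)"
  unfolding grad_def[abs_def] by (intro continuous_intros smooth_fun_dderiv)

text \<open>The Leibniz rule follows by testing the weak gradient of \<open>f\<close> with
  \<open>\<eta> x * \<phi> x\<close>, which is again a test function. It serves to localise
  \<open>f\<close>: the product has compact support, and so does its weak gradient.\<close>

lemma weak_grad_mult:
  fixes \<eta> :: "'a::euclidean_space \<Rightarrow> real"
  assumes fG: "weak_grad f G" and \<eta>: "test_fun \<eta>"
  shows "weak_grad (\<lambda>x. \<eta> x * f x) (\<lambda>x. \<eta> x *\<^sub>R G x + f x *\<^sub>R grad \<eta> x)"
proof -
  have fi: "compact K \<Longrightarrow> set_integrable lborel K f" and Gi: "compact K \<Longrightarrow> set_integrable lborel K G" for K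
    using fG by (auto simp: weak_grad_def)
  have sm: "smooth_fun \<eta>" using \<eta> by (simp add: test_fun_def)
  obtain r where r: "\<And>x. norm x > r \<Longrightarrow> \<eta> x = 0" "\<And>x v. norm x > r \<Longrightarrow> dderiv \<eta> [v] x = 0"
    using test_fun_support[OF \<eta>] by blast
  have \<eta>c: "continuous_on UNIV \<eta>" using smooth_fun_dderiv(1)[OF sm, of UNIV "[]"] by simp
  have int: "integrable lborel (\<lambda>x. \<eta> x *\<^sub>R f x)" "integrable lborel (\<lambda>x. \<eta> x *\<^sub>R G x)"
    by (rule integrable_mult_continuous_compact_support[where r = r]; use fi Gi r \<eta>c in auto)+
  have intD: "integrable lborel (\<lambda>x. dderiv \<eta> [v] x *\<^sub>R f x)" for v
    by (rule integrable_mult_continuous_compact_support[where r = r])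
       (use fi r(2) smooth_fun_dderiv(1)[OF sm, of UNIV "[v]"] in auto)
  \<comment> \<open>Expanding the gradient in coordinates reduces integrability to scalar products
    of \<open>f\<close> with continuous functions of compact support.\<close>
  have "(\<lambda>x. f x *\<^sub>R grad \<eta> x) = (\<lambda>x. \<Sum>b\<in>Basis. (dderiv \<eta> [b] x *\<^sub>R f x) *\<^sub>R b)"
    by (simp add: grad_def scaleR_sum_right mult.commute)
  moreover have "integrable lborel (\<lambda>x. \<Sum>b\<in>Basis. (dderiv \<eta> [b] x *\<^sub>R f x) *\<^sub>R b)"
    by (intro Bochner_Integration.integrable_sum integrable_scaleR_left intD)
  ultimately have int': "integrable lborel (\<lambda>x. \<eta> x *\<^sub>R G x + f x *\<^sub>R grad \<eta> x)"
    using int(2) by simp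
  show ?thesis
    unfolding weak_grad_def
  proof (intro conjI allI impI ballI)
    fix K :: "'a set" assume "compact K"
    then have "K \<in> sets lborel" by (simp add: borel_compact)
    then show "set_integrable lborel K (\<lambda>x. \<eta> x * f x)"
      "set_integrable lborel K (\<lambda>x. \<eta> x *\<^sub>R G x + f x *\<^sub>R grad \<eta> x)"
      unfolding set_integrable_def using int int' by (auto intro!: integrable_mult_indicator simp del: real_scaleR_def) (use int integrable_mult_indicator in auto)
  next
    fix \<phi> :: "'a \<Rightarrow> real" and b :: 'a assume \<phi>: "test_fun \<phi>" and b: "b \<in> Basis"
    have sm\<phi>: "smooth_fun \<phi>" using \<phi> by (simp add: test_fun_def)
    have \<phi>c: "continuous_on UNIV \<phi>" "continuous_on UNIV (dderiv \<phi> [b])" "continuous_on UNIV (dderiv \<eta> [b])"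
      using smooth_fun_dderiv(1)[OF sm\<phi>, of UNIV "[]"] smooth_fun_dderiv(1)[OF sm\<phi>, of UNIV "[b]"]
        smooth_fun_dderiv(1)[OF sm, of UNIV "[b]"] by simp_all
    have "((\<lambda>x. \<eta> x * \<phi> x) has_derivative (\<lambda>v. \<eta> x * dderiv \<phi> [v] x + dderiv \<eta> [v] x * \<phi> x)) (at x)" for x
      using smooth_fun_dderiv(2)[OF sm, of "[]" x] smooth_fun_dderiv(2)[OF sm\<phi>, of "[]" x]
      by (intro has_derivative_mult has_derivative_dderiv) simp_all
    then have D: "dderiv (\<lambda>x. \<eta> x * \<phi> x) [b] = (\<lambda>x. \<eta> x * dderiv \<phi> [b] x + dderiv \<eta> [b] x * \<phi> x)"
      by (rule dderiv_eqI)
    have I1: "integrable lborel (\<lambda>x. (\<eta> x * dderiv \<phi> [b] x) *\<^sub>R f x)"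
      by (rule integrable_mult_continuous_compact_support[where r = r])
         (use fi r \<eta>c \<phi>c in \<open>auto intro!: continuous_intros simp del: dderiv.simps\<close>)
    have I2: "integrable lborel (\<lambda>x. (dderiv \<eta> [b] x * \<phi> x) *\<^sub>R f x)"
      by (rule integrable_mult_continuous_compact_support[where r = r])
         (use fi r \<phi>c in \<open>auto intro!: continuous_intros simp del: dderiv.simps\<close>)
    have "integrable lborel (\<lambda>x. ((\<eta> x * \<phi> x) *\<^sub>R G x) \<bullet> b)"
      by (intro integrable_inner_left impI integrable_mult_continuous_compact_support[where r = r])
         (use Gi r \<eta>c \<phi>c in \<open>auto intro!: continuous_intros\<close>)
    then have I3: "integrable lborel (\<lambda>x. (G x \<bullet> b) * (\<eta> x * \<phi> x))"
      by (simp add: mult.commute)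
    have "(\<integral>x. f x * dderiv (\<lambda>x. \<eta> x * \<phi> x) [b] x \<partial>lborel) = - (\<integral>x. (G x \<bullet> b) * (\<eta> x * \<phi> x) \<partial>lborel)"
      using fG test_fun_mult[OF \<eta> sm\<phi>] b unfolding weak_grad_def by blast
    moreover have "(\<integral>x. f x * dderiv (\<lambda>x. \<eta> x * \<phi> x) [b] x \<partial>lborel) =
        (\<integral>x. (\<eta> x * dderiv \<phi> [b] x) *\<^sub>R f x \<partial>lborel) + (\<integral>x. (dderiv \<eta> [b] x * \<phi> x) *\<^sub>R f x \<partial>lborel)"
      unfolding D Bochner_Integration.integral_add[OF I1 I2, symmetric]
      by (simp add: algebra_simps del: dderiv.simps)
    moreover have "(\<integral>x. ((\<eta> x *\<^sub>R G x + f x *\<^sub>R grad \<eta> x) \<bullet> b) * \<phi> x \<partial>lborel) =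
        (\<integral>x. (G x \<bullet> b) * (\<eta> x * \<phi> x) \<partial>lborel) + (\<integral>x. (dderiv \<eta> [b] x * \<phi> x) *\<^sub>R f x \<partial>lborel)"
      unfolding Bochner_Integration.integral_add[OF I3 I2, symmetric]
      by (simp add: algebra_simps inner_add_left grad_inner_Basis b del: dderiv.simps)
    ultimately show "(\<integral>x. \<eta> x * f x * dderiv \<phi> [b] x \<partial>lborel) =
        - (\<integral>x. ((\<eta> x *\<^sub>R G x + f x *\<^sub>R grad \<eta> x) \<bullet> b) * \<phi> x \<partial>lborel)"
      by (simp add: algebra_simps del: dderiv.simps)
  qed
qed

section \<open>Passing from the weighted measure to Lebesgue measure\<close>

lemma integral_mu:
  fixes F :: "'a::euclidean_space \<Rightarrow> real"
  assumes "continuous_on UNIV V" "F \<in> borel_measurable borel"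
  shows "(\<integral>x. F x \<partial>mu V) = (\<integral>x. F x * exp (- V x) \<partial>lborel)"
proof -
  have [measurable]: "V \<in> borel_measurable borel" using assms by (intro borel_measurable_continuous_onI)
  show ?thesis
    unfolding mu_def using assms by (subst integral_density) (auto simp: mult.commute)
qed

lemma integrable_mu:
  fixes F :: "'a::euclidean_space \<Rightarrow> real"
  assumes "continuous_on UNIV V" "F \<in> borel_measurable borel"
  shows "integrable (mu V) F \<longleftrightarrow> integrable lborel (\<lambda>x. F x * exp (- V x))"
proof -
  have [measurable]: "V \<in> borel_measurable borel" using assms by (intro borel_measurable_continuous_onI)
  show ?thesis
    unfolding mu_def using assms by (subst integrable_density) (auto simp: mult.commute)
qed

lemma linear_euclidean_expansion:
  fixes g :: "'a::euclidean_space \<Rightarrow> real"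
  assumes "linear g"
  shows "g v = (\<Sum>b\<in>Basis. (v \<bullet> b) * g b)"
  by (subst euclidean_representation[of v, symmetric])
     (simp add: linear_sum[OF assms] linear_scale[OF assms])

section \<open>Radial kernels and their first two directional derivatives\<close>

definition ker0 :: "real \<Rightarrow> 'a::euclidean_space \<Rightarrow> real" where
  "ker0 r z = bump 1 (r\<^sup>2) 1 0 z"

text \<open>\<open>ker1 r b\<close> and \<open>ker2 r b\<close> are the first and second derivatives
  of \<open>ker0 r\<close> in direction \<open>b\<close>. The closed forms make continuity, support
  and parity immediate. The kernel is not normalised; its mass is divided out at the end.\<close>

definition ker1 :: "real \<Rightarrow> 'a::euclidean_space \<Rightarrow> 'a \<Rightarrow> real" where
  "ker1 r b z = bump (flat_exp_deriv 1) (r\<^sup>2) 1 0 z * (- 2 * (z \<bullet> b))"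

definition ker2 :: "real \<Rightarrow> 'a::euclidean_space \<Rightarrow> 'a \<Rightarrow> real" where
  "ker2 r b z = bump (flat_exp_deriv 1) (r\<^sup>2) 1 0 z * (- 2 * (b \<bullet> b)) +
     bump (flat_exp_deriv (flat_exp_deriv 1)) (r\<^sup>2) 1 0 z * (- 2 * (z \<bullet> b)) * (- 2 * (z \<bullet> b))"

lemma bump_minus: "bump p \<alpha> \<gamma> 0 (- z) = bump p \<alpha> \<gamma> 0 z"
  by (simp add: bump_def)

lemma bump_shift: "bump p \<alpha> \<gamma> 0 (x - a) = bump p \<alpha> \<gamma> a x"
  by (simp add: bump_def)

lemma ker_continuous:
  "continuous_on A (ker0 r)" "continuous_on A (ker1 r b)" "continuous_on A (ker2 r b)"
  unfolding ker0_def[abs_def] ker1_def[abs_def] ker2_def[abs_def]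
  by (intro continuous_intros bump_continuous)+

lemma ker_eq_0:
  assumes "r > 0" "norm z > r"
  shows "ker0 r z = 0" "ker1 r b z = 0" "ker2 r b z = 0"
  using assms bump_eq_0(1)[of r z 0] by (auto simp: ker0_def ker1_def ker2_def)

text \<open>A radial function is even, its first derivatives are odd and its second ones even. These
  signs convert derivatives in \<open>y\<close>, produced by the equation for \<open>u\<close>, into
  derivatives in \<open>x\<close>, which the weak gradient can absorb.\<close>

lemma ker_minus:
  "ker0 r (x - y) = ker0 r (y - x)" "ker1 r b (x - y) = - ker1 r b (y - x)" "ker2 r b (x - y) = ker2 r b (y - x)"
  using bump_minus[of _ "r\<^sup>2" 1 "x - y"] by (auto simp: ker0_def ker1_def ker2_def algebra_simps)

lemma ker0_nonneg: "ker0 r z \<ge> 0"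
  by (simp add: ker0_def bump_def flat_exp_def)

lemma ker0_has_derivative: "((\<lambda>x. ker0 r (x - a)) has_derivative (\<lambda>v. ker1 r v (x - a))) (at x)"
  using bump_has_derivative[of 1 "r\<^sup>2" 1 a x] unfolding ker0_def ker1_def bump_shift by simp

lemma ker1_has_derivative:
  "((\<lambda>x. ker1 r b (x - a)) has_derivative (\<lambda>v. bump (flat_exp_deriv 1) (r\<^sup>2) 1 0 (x - a) * (- 2 * (v \<bullet> b)) +
     bump (flat_exp_deriv (flat_exp_deriv 1)) (r\<^sup>2) 1 0 (x - a) * (- 2 * ((x - a) \<bullet> v)) * (- 2 * ((x - a) \<bullet> b)))) (at x)"
  unfolding ker1_def bump_shift
  by (rule derivative_eq_intros bump_has_derivative refl)+ auto

lemma dderiv_ker: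
  "dderiv (\<lambda>x. ker0 r (x - a)) [b] = (\<lambda>x. ker1 r b (x - a))"
  "dderiv (\<lambda>x. ker0 r (x - a)) [b, b] = (\<lambda>x. ker2 r b (x - a))"
  "dderiv (\<lambda>x. ker1 r b (x - a)) [b] = (\<lambda>x. ker2 r b (x - a))"
proof -
  show 1: "dderiv (\<lambda>x. ker0 r (x - a)) [b] = (\<lambda>x. ker1 r b (x - a))"
    by (rule dderiv_eqI[OF ker0_has_derivative])
  show 2: "dderiv (\<lambda>x. ker1 r b (x - a)) [b] = (\<lambda>x. ker2 r b (x - a))"
    unfolding dderiv_eqI[OF ker1_has_derivative] by (simp add: ker2_def)
  show "dderiv (\<lambda>x. ker0 r (x - a)) [b, b] = (\<lambda>x. ker2 r b (x - a))"
    using dderiv_append[of _ "[b]" "[b]"] 1 2 by (metis append_Cons append_Nil)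
qed

lemma test_fun_ker:
  assumes "r > 0"
  shows "test_fun (\<lambda>x. ker0 r (x - a))" "test_fun (\<lambda>x. ker1 r b (x - a))"
proof -
  have "norm x \<le> r + norm a" if "\<not> norm (x - a) > r" for x
    using that norm_triangle_ineq[of "x - a" a] by simp
  then have "bounded {x. ker0 r (x - a) \<noteq> 0}" "bounded {x. ker1 r b (x - a) \<noteq> 0}"
    using ker_eq_0[OF assms] unfolding bounded_iff by blast+
  moreover have "smooth_fun (\<lambda>x. ker0 r (x - a))" "smooth_fun (\<lambda>x. ker1 r b (x - a))"
    unfolding ker0_def ker1_def bump_shift
    by (intro smooth_fun_mult smooth_fun_bump smooth_fun_const smooth_fun_inner)+
  ultimately show "test_fun (\<lambda>x. ker0 r (x - a))" "test_fun (\<lambda>x. ker1 r b (x - a))"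
    by (auto simp: test_fun_def)
qed

section \<open>The mollified estimate\<close>

lemma mollified_estimate:
  fixes V u w a :: "'a::euclidean_space \<Rightarrow> real" and H :: "'a \<Rightarrow> 'a"
  assumes V: "C_k 1 V"
    and u: "L-lipschitz_on UNIV u"
    and w: "continuous_on UNIV w"
    and sol: "weak_solution V u w"
    and aH: "weak_grad a H"
    and supp: "\<And>x. norm x > R \<Longrightarrow> a x = 0" "\<And>x. norm x > R \<Longrightarrow> H x = 0"
    and ai: "integrable lborel a" and Hi: "integrable lborel H"
    and r: "r > 0"
  shows "\<bar>\<integral>x. a x * (\<integral>y. (w y * exp (- V y)) * ker0 r (x - y) \<partial>lborel) \<partial>lborel\<bar>
    \<le> L * (\<integral>x. norm (H x) * (\<integral>y. exp (- V y) * ker0 r (x - y) \<partial>lborel) \<partial>lborel)"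
proof -
  define D where "D b y = dderiv V [b] y" for b y
  define P where "P y = exp (- V y)" for y
  have "C_k (Suc 0) V" using V by simp
  then have Vd: "V differentiable (at x)" and "C_k 0 (dderiv V [b])" for x b
    unfolding C_k_Suc by blast+
  then have Dc: "continuous_on A (D b)" for A b
    unfolding D_def[abs_def] C_k_0 using continuous_on_subset by blast
  have Vder: "(V has_derivative (\<lambda>v. D v x)) (at x)" for x
    unfolding D_def by (rule has_derivative_dderiv[OF Vd])
  have Vc: "continuous_on A V" for A
    using Vd by (meson differentiable_imp_continuous_on differentiable_at_withinI differentiable_on_def)
  have Pc: "continuous_on A P" for A
    unfolding P_def[abs_def] by (intro continuous_intros Vc)
  have uc: "continuous_on A u" for A
    using lipschitz_on_continuous_on[OF u] continuous_on_subset by blast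
  note kc = ker_continuous and k0 = ker_eq_0[OF r]
  have kc': "continuous_on A (\<lambda>y. ker0 r (x - y))" "continuous_on A (\<lambda>y. ker1 r b (x - y))"
    "continuous_on A (\<lambda>y. ker2 r b (x - y))" for A b x
    by (auto intro!: continuous_on_compose2[OF kc(1)[of UNIV]] continuous_on_compose2[OF kc(2)[of UNIV]]
        continuous_on_compose2[OF kc(3)[of UNIV]] continuous_intros)
  \<comment> \<open>These are the continuous coefficients of the second and first order kernels once
    the generator is written out against the density \<open>P\<close>.\<close>
  define c1 c2 where "c1 y = u y * P y" and "c2 b y = u y * P y * D b y" for b y
  have cc: "continuous_on A c1" "continuous_on A (c2 b)" for A b
    unfolding c1_def[abs_def] c2_def[abs_def] by (intro continuous_intros uc Pc Dc)+
  have I: "integrable lborel (\<lambda>y. c y * ker0 r (x - y))" "integrable lborel (\<lambda>y. c y * ker1 r b (x - y))"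
    "integrable lborel (\<lambda>y. c y * ker2 r b (x - y))" if "continuous_on UNIV c" for c b x
    by (rule integrable_continuous_compact_support[where a = x and r = r];
        use that k0[of "x - _"] in \<open>auto intro!: continuous_intros kc' simp: norm_minus_commute[of _ x]\<close>)+

  \<comment> \<open>The equation is tested with the kernel centred at \<open>x\<close>. The drift
    enters the generator with a minus sign, which becomes a plus because \<open>ker1\<close> is
    odd.\<close>
  have eq1: "(\<integral>y. (w y * P y) * ker0 r (x - y) \<partial>lborel) =
      (\<Sum>b\<in>Basis. (\<integral>y. c1 y * ker2 r b (x - y) \<partial>lborel) + (\<integral>y. c2 b y * ker1 r b (x - y) \<partial>lborel))" for x
  proof -
    have Lg: "Lgen V (\<lambda>y. ker0 r (y - x)) y = (\<Sum>b\<in>Basis. ker2 r b (x - y) + D b y * ker1 r b (x - y))" for y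
      unfolding Lgen_def laplacian_def grad_inner dderiv_ker D_def
      by (simp add: ker_minus(2)[of r _ x y] ker_minus(3)[of r _ x y] sum_subtractf sum.distrib sum_negf)
    have wm: "w \<in> borel_measurable borel" "u \<in> borel_measurable borel"
      using w uc by (auto intro: borel_measurable_continuous_onI)
    have k0m: "(\<lambda>y. ker0 r (y - x)) \<in> borel_measurable borel"
      by (intro borel_measurable_continuous_onI continuous_on_compose2[OF kc(1)[of UNIV]] continuous_intros) auto
    have Lm: "(\<lambda>y. \<Sum>b\<in>Basis. ker2 r b (x - y) + D b y * ker1 r b (x - y)) \<in> borel_measurable borel"
      by (intro borel_measurable_continuous_onI continuous_intros kc' Dc)
    have "(\<integral>y. u y * Lgen V (\<lambda>y. ker0 r (y - x)) y \<partial>mu V) = (\<integral>y. w y * ker0 r (y - x) \<partial>mu V)"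
      using sol test_fun_ker(1)[OF r] unfolding weak_solution_def by blast
    then have "(\<integral>y. u y * (\<Sum>b\<in>Basis. ker2 r b (x - y) + D b y * ker1 r b (x - y)) * exp (- V y) \<partial>lborel) =
        (\<integral>y. w y * ker0 r (y - x) * exp (- V y) \<partial>lborel)"
      unfolding Lg using Vc wm k0m Lm by (subst (asm) (1 2) integral_mu) auto
    moreover have "u y * (\<Sum>b\<in>Basis. ker2 r b (x - y) + D b y * ker1 r b (x - y)) * exp (- V y) =
        (\<Sum>b\<in>Basis. c1 y * ker2 r b (x - y) + c2 b y * ker1 r b (x - y))" for y
      by (simp add: c1_def c2_def P_def sum_distrib_left sum_distrib_right algebra_simps)
    moreover have "w y * ker0 r (y - x) * exp (- V y) = (w y * P y) * ker0 r (x - y)" for y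
      by (simp add: P_def ker_minus(1)[of r x y])
    ultimately have "(\<integral>y. (w y * P y) * ker0 r (x - y) \<partial>lborel) =
        (\<integral>y. (\<Sum>b\<in>Basis. c1 y * ker2 r b (x - y) + c2 b y * ker1 r b (x - y)) \<partial>lborel)"
      by simp
    also have "\<dots> = (\<Sum>b\<in>Basis. (\<integral>y. c1 y * ker2 r b (x - y) \<partial>lborel) + (\<integral>y. c2 b y * ker1 r b (x - y) \<partial>lborel))"
      using I(3)[OF cc(1)] I(2)[OF cc(2)] by (subst Bochner_Integration.integral_sum) auto
    finally show ?thesis .
  qed

  \<comment> \<open>As functions of \<open>x\<close>, \<open>ker1\<close> and \<open>ker2\<close>
    are derivatives of the test functions \<open>ker0\<close> and \<open>ker1\<close>; the weak
    gradient therefore lowers the order of the kernel by one.\<close>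
  have g1: "(\<integral>x. a x * ker1 r b (x - y) \<partial>lborel) = - (\<integral>x. (H x \<bullet> b) * ker0 r (x - y) \<partial>lborel)"
   and g2: "(\<integral>x. a x * ker2 r b (x - y) \<partial>lborel) = - (\<integral>x. (H x \<bullet> b) * ker1 r b (x - y) \<partial>lborel)"
    if b: "b \<in> Basis" for b y
  proof -
    have *: "(\<integral>x. a x * dderiv \<phi> [b] x \<partial>lborel) = - (\<integral>x. (H x \<bullet> b) * \<phi> x \<partial>lborel)"
      if "test_fun \<phi>" for \<phi>
      using aH that b unfolding weak_grad_def by blast
    show "(\<integral>x. a x * ker1 r b (x - y) \<partial>lborel) = - (\<integral>x. (H x \<bullet> b) * ker0 r (x - y) \<partial>lborel)"
      using *[OF test_fun_ker(1)[OF r, of y]] unfolding dderiv_ker .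
    show "(\<integral>x. a x * ker2 r b (x - y) \<partial>lborel) = - (\<integral>x. (H x \<bullet> b) * ker1 r b (x - y) \<partial>lborel)"
      using *[OF test_fun_ker(2)[OF r, of b y]] unfolding dderiv_ker .
  qed

  have Hb: "integrable lborel (\<lambda>x. H x \<bullet> b)" for b using Hi by simp
  have Hsupp: "norm x > R \<Longrightarrow> H x \<bullet> b = 0" for x b using supp(2) by simp
  note Fa = convolution_Fubini[OF ai supp(1)] and FH = convolution_Fubini[OF Hb Hsupp]

  \<comment> \<open>This is the factor that multiplies the \<open>b\<close>-component of
    \<open>H x\<close> once a derivative has been moved to \<open>a\<close>. It turns out to be the
    integral of \<open>u\<close> against the \<open>b\<close>-derivative in \<open>y\<close> of
    \<open>P y * ker0 r (y - x)\<close>.\<close>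
  define T where "T x b = - ((\<integral>y. c1 y * ker1 r b (x - y) \<partial>lborel) + (\<integral>y. c2 b y * ker0 r (x - y) \<partial>lborel))" for x b

  have Tint: "integrable lborel (\<lambda>x. (H x \<bullet> b) * T x b)" for b
  proof -
    have "integrable lborel (\<lambda>x. - ((H x \<bullet> b) * (\<integral>y. c1 y * ker1 r b (x - y) \<partial>lborel)
        + (H x \<bullet> b) * (\<integral>y. c2 b y * ker0 r (x - y) \<partial>lborel)))"
      by (intro Bochner_Integration.integrable_add integrable_minus FH(1)[where r = r] cc kc k0)
    then show ?thesis by (simp add: T_def algebra_simps)
  qed

  \<comment> \<open>Each term takes three moves: Fubini brings the integral over \<open>x\<close>
    inside, the weak gradient replaces \<open>a\<close> by a component of \<open>H\<close>, and
    Fubini restores the original order.\<close>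
  have eq2: "(\<integral>x. a x * (\<integral>y. c1 y * ker2 r b (x - y) \<partial>lborel) \<partial>lborel)
      + (\<integral>x. a x * (\<integral>y. c2 b y * ker1 r b (x - y) \<partial>lborel) \<partial>lborel)
      = (\<integral>x. (H x \<bullet> b) * T x b \<partial>lborel)" if b: "b \<in> Basis" for b
  proof -
    have "(\<integral>x. a x * (\<integral>y. c1 y * ker2 r b (x - y) \<partial>lborel) \<partial>lborel)
        = (\<integral>y. c1 y * (\<integral>x. a x * ker2 r b (x - y) \<partial>lborel) \<partial>lborel)"
      by (rule Fa(3)[where r = r]) (use cc kc k0 in auto)
    also have "\<dots> = - (\<integral>y. c1 y * (\<integral>x. (H x \<bullet> b) * ker1 r b (x - y) \<partial>lborel) \<partial>lborel)"
      by (simp add: g2[OF b])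
    also have "(\<integral>y. c1 y * (\<integral>x. (H x \<bullet> b) * ker1 r b (x - y) \<partial>lborel) \<partial>lborel)
        = (\<integral>x. (H x \<bullet> b) * (\<integral>y. c1 y * ker1 r b (x - y) \<partial>lborel) \<partial>lborel)"
      by (rule FH(3)[where r = r, symmetric]) (use cc kc k0 in auto)
    finally have A: "(\<integral>x. a x * (\<integral>y. c1 y * ker2 r b (x - y) \<partial>lborel) \<partial>lborel)
        = - (\<integral>x. (H x \<bullet> b) * (\<integral>y. c1 y * ker1 r b (x - y) \<partial>lborel) \<partial>lborel)" .
    have "(\<integral>x. a x * (\<integral>y. c2 b y * ker1 r b (x - y) \<partial>lborel) \<partial>lborel)
        = (\<integral>y. c2 b y * (\<integral>x. a x * ker1 r b (x - y) \<partial>lborel) \<partial>lborel)"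
      by (rule Fa(3)[where r = r]) (use cc kc k0 in auto)
    also have "\<dots> = - (\<integral>y. c2 b y * (\<integral>x. (H x \<bullet> b) * ker0 r (x - y) \<partial>lborel) \<partial>lborel)"
      by (simp add: g1[OF b])
    also have "(\<integral>y. c2 b y * (\<integral>x. (H x \<bullet> b) * ker0 r (x - y) \<partial>lborel) \<partial>lborel)
        = (\<integral>x. (H x \<bullet> b) * (\<integral>y. c2 b y * ker0 r (x - y) \<partial>lborel) \<partial>lborel)"
      by (rule FH(3)[where r = r, symmetric]) (use cc kc k0 in auto)
    finally have B: "(\<integral>x. a x * (\<integral>y. c2 b y * ker1 r b (x - y) \<partial>lborel) \<partial>lborel)
        = - (\<integral>x. (H x \<bullet> b) * (\<integral>y. c2 b y * ker0 r (x - y) \<partial>lborel) \<partial>lborel)" .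
    have "integrable lborel (\<lambda>x. (H x \<bullet> b) * (\<integral>y. c1 y * ker1 r b (x - y) \<partial>lborel))"
      "integrable lborel (\<lambda>x. (H x \<bullet> b) * (\<integral>y. c2 b y * ker0 r (x - y) \<partial>lborel))"
      by (intro FH(1)[where r = r] cc kc k0; assumption)+
    then show ?thesis
      unfolding A B T_def by (simp add: algebra_simps)
  qed

  have main: "(\<integral>x. a x * (\<integral>y. (w y * P y) * ker0 r (x - y) \<partial>lborel) \<partial>lborel)
      = (\<integral>x. (\<Sum>b\<in>Basis. (H x \<bullet> b) * T x b) \<partial>lborel)"
  proof -
    have i: "integrable lborel (\<lambda>x. a x * (\<integral>y. c1 y * ker2 r b (x - y) \<partial>lborel))"
      "integrable lborel (\<lambda>x. a x * (\<integral>y. c2 b y * ker1 r b (x - y) \<partial>lborel))" for b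
      by (intro Fa(1)[where r = r] cc kc k0; assumption)+
    have "(\<integral>x. a x * (\<integral>y. (w y * P y) * ker0 r (x - y) \<partial>lborel) \<partial>lborel)
      = (\<integral>x. (\<Sum>b\<in>Basis. a x * (\<integral>y. c1 y * ker2 r b (x - y) \<partial>lborel) +
           a x * (\<integral>y. c2 b y * ker1 r b (x - y) \<partial>lborel)) \<partial>lborel)"
      unfolding eq1 by (simp add: sum_distrib_left distrib_left)
    also have "\<dots> = (\<Sum>b\<in>Basis. (\<integral>x. (H x \<bullet> b) * T x b \<partial>lborel))"
      using i by (simp add: Bochner_Integration.integral_sum eq2)
    finally show ?thesis
      using Tint by (simp add: Bochner_Integration.integral_sum)
  qed

  \<comment> \<open>With \<open>x\<close> fixed, \<open>H x\<close> is a constant vector and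
    everything happens in the variable \<open>y\<close>.\<close>
  have bound: "\<bar>\<Sum>b\<in>Basis. (H x \<bullet> b) * T x b\<bar> \<le> L * (norm (H x) * (\<integral>y. P y * ker0 r (x - y) \<partial>lborel))" for x
  proof -
    define k where "k y = P y * ker0 r (y - x)" for y
    define k' where "k' y v = P y * ker1 r v (y - x) - P y * D v y * ker0 r (y - x)" for y v
    have k': "(k has_derivative k' y) (at y)" for y
      unfolding k_def k'_def P_def
      by (rule derivative_eq_intros Vder ker0_has_derivative refl)+ (auto simp: algebra_simps)
    have k'2: "k' y v = - (P y * ker1 r v (x - y) + P y * D v y * ker0 r (x - y))" for y v
      unfolding k'_def by (simp add: ker_minus(1)[of r x y] ker_minus(2)[of r _ x y])
    have k'c: "continuous_on UNIV (\<lambda>y. k' y v)" for v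
      unfolding k'2 by (intro continuous_intros Pc Dc kc')
    have Tk': "T x b = (\<integral>y. u y * k' y b \<partial>lborel)"
      and Tk'i: "integrable lborel (\<lambda>y. u y * k' y b)" for b
    proof -
      have e: "u y * k' y b = - (c1 y * ker1 r b (x - y) + c2 b y * ker0 r (x - y))" for y
        by (simp add: k'2 c1_def c2_def algebra_simps)
      show "T x b = (\<integral>y. u y * k' y b \<partial>lborel)" "integrable lborel (\<lambda>y. u y * k' y b)"
        unfolding e T_def using I(2)[OF cc(1), of b x] I(1)[OF cc(2), of b x] by simp_all
    qed
    have "(\<Sum>b\<in>Basis. (H x \<bullet> b) * T x b) = (\<integral>y. (\<Sum>b\<in>Basis. (H x \<bullet> b) * (u y * k' y b)) \<partial>lborel)"
      unfolding Tk' using Tk'i by (subst Bochner_Integration.integral_sum) auto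
    \<comment> \<open>Linearity of \<open>k' y\<close> collapses the coordinate sum to one
      derivative in the direction \<open>H x\<close>. Estimating it as a whole gives the Euclidean
      norm of \<open>H x\<close> with no dimensional constant.\<close>
    also have "\<dots> = (\<integral>y. u y * k' y (H x) \<partial>lborel)"
      by (subst linear_euclidean_expansion[OF has_derivative_linear[OF k'], of _ "H x"])
         (simp add: sum_distrib_left algebra_simps)
    also have "\<bar>\<dots>\<bar> \<le> L * norm (H x) * (\<integral>y. \<bar>k y\<bar> \<partial>lborel)"
      by (rule lipschitz_integral_derivative_le[OF u k' k'c, where a = x and r = r]) (use k0 in \<open>auto simp: k_def\<close>)
    also have "(\<integral>y. \<bar>k y\<bar> \<partial>lborel) = (\<integral>y. P y * ker0 r (x - y) \<partial>lborel)"
      by (simp add: k_def P_def abs_mult ker0_nonneg ker_minus(1)[of r x])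
    finally show ?thesis by (simp add: mult.assoc)
  qed

  have "integrable lborel (\<lambda>x. norm (H x) * (\<integral>y. P y * ker0 r (x - y) \<partial>lborel))"
    by (rule convolution_Fubini(1)[where R = R and r = r]) (use Hi supp Pc kc k0 in auto)
  then have "\<bar>\<integral>x. (\<Sum>b\<in>Basis. (H x \<bullet> b) * T x b) \<partial>lborel\<bar>
      \<le> (\<integral>x. L * (norm (H x) * (\<integral>y. P y * ker0 r (x - y) \<partial>lborel)) \<partial>lborel)"
    using bound Tint by (intro integral_abs_le) auto
  then show ?thesis
    unfolding main[unfolded P_def] by (simp add: P_def)
qed

section \<open>The kernels as an approximate identity\<close>

text \<open>A nonnegative kernel with zero integral would vanish almost everywhere, yet this one is
  positive on an open ball, which is not negligible. Positivity is what permits division by the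
  mass.\<close>

lemma integral_ker0_pos:
  assumes "r > 0"
  shows "(\<integral>z. ker0 r z \<partial>lborel) > 0"
proof -
  have int: "integrable lborel (ker0 r :: 'a \<Rightarrow> real)"
    by (rule integrable_continuous_compact_support[where a = 0 and r = r])
       (use ker_eq_0[OF assms] ker_continuous in auto)
  have "(\<integral>z. ker0 r (z::'a) \<partial>lborel) \<noteq> 0"
  proof
    assume "(\<integral>z. ker0 r (z::'a) \<partial>lborel) = 0"
    then have "AE z in lborel. ker0 r (z::'a) = 0"
      using int ker0_nonneg by (subst (asm) integral_nonneg_eq_0_iff_AE) auto
    then obtain N :: "'a set" where N: "N \<in> null_sets lborel" "{z. ker0 r z \<noteq> 0} \<subseteq> N"
      by (auto elim!: AE_E3 simp: eventually_ae_filter)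
    have "ball 0 r \<subseteq> {z::'a. ker0 r z \<noteq> 0}"
    proof
      fix z :: 'a assume "z \<in> ball 0 r"
      then have "z \<bullet> z < r\<^sup>2"
        by (simp add: power_strict_mono flip: power2_norm_eq_inner)
      then show "z \<in> {z. ker0 r z \<noteq> 0}"
        by (simp add: ker0_def bump_def flat_exp_def)
    qed
    with N have "negligible (ball (0::'a) r)"
      using negligible_subset null_sets_completionI[of N lborel] by (metis negligible_iff_null_sets order_trans)
    then show False
      using assms open_not_negligible[of "ball (0::'a) r"] by auto
  qed
  moreover have "(\<integral>z. ker0 r (z::'a) \<partial>lborel) \<ge> 0"
    by (intro Bochner_Integration.integral_nonneg ker0_nonneg)
  ultimately show ?thesis by simp
qed

text \<open>Uniform continuity on a slightly larger ball controls \<open>c y - c x\<close> wherever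
  the kernel is nonzero. The mass appears on both sides in place of a normalisation.\<close>

lemma mollification_close:
  fixes c :: "'a::euclidean_space \<Rightarrow> real"
  assumes c: "continuous_on UNIV c" and "\<delta> > 0"
  obtains r0 where "r0 > 0" "\<And>r x. 0 < r \<Longrightarrow> r \<le> r0 \<Longrightarrow> norm x \<le> R \<Longrightarrow>
    \<bar>(\<integral>y. c y * ker0 r (x - y) \<partial>lborel) - c x * (\<integral>z. ker0 r (z::'a) \<partial>lborel)\<bar> \<le> \<delta> * (\<integral>z. ker0 r (z::'a) \<partial>lborel)"
proof -
  have "uniformly_continuous_on (cball 0 (R + 1)) c"
    using c by (intro compact_uniformly_continuous) (auto intro: continuous_on_subset)
  then obtain d where d: "d > 0" "\<And>x y. \<lbrakk>x \<in> cball 0 (R + 1); y \<in> cball 0 (R + 1); dist y x < d\<rbrakk> \<Longrightarrow> dist (c y) (c x) < \<delta>"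
    using \<open>\<delta> > 0\<close> unfolding uniformly_continuous_on_def by metis
  show ?thesis
  \<comment> \<open>The bound 1 keeps \<open>y\<close> in the ball of radius \<open>R + 1\<close>;
    halving \<open>d\<close> makes the distance strictly less than \<open>d\<close> although the
    support of the kernel only gives \<open>norm (y - x) \<le> r\<close>.\<close>
  proof (rule that[of "min 1 (d / 2)"])
    fix r :: real and x :: 'a assume r: "0 < r" "r \<le> min 1 (d / 2)" and x: "norm x \<le> R"
    have kc: "continuous_on UNIV (\<lambda>y. ker0 r (x - y))"
      by (intro continuous_on_compose2[OF ker_continuous(1)[of UNIV]] continuous_intros) auto
    have km: "ker0 r \<in> borel_measurable (borel :: 'a measure)"
      by (intro borel_measurable_continuous_onI ker_continuous)
    have supp: "norm (y - x) > r \<Longrightarrow> ker0 r (x - y) = 0" for y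
      using ker_eq_0(1)[OF r(1)] by (simp add: norm_minus_commute)
    have I: "integrable lborel (\<lambda>y. g y * ker0 r (x - y))" if "continuous_on UNIV g" for g
      by (rule integrable_continuous_compact_support[where a = x and r = r])
         (use that supp kc in \<open>auto intro!: continuous_intros\<close>)
    have I1: "integrable lborel (\<lambda>y. ker0 r (x - y))" using I[of "\<lambda>_. 1"] by simp
    have m: "(\<integral>z. ker0 r (z::'a) \<partial>lborel) = (\<integral>y. ker0 r (x - y) \<partial>lborel)"
      using lborel_integral_translation[OF km, of "- x"] by (simp add: ker_minus(1)[of r x])
    have near: "\<bar>(c y - c x) * ker0 r (x - y)\<bar> \<le> \<delta> * ker0 r (x - y)" for y
    proof (cases "norm (y - x) > r")
      case False
      then have "norm y \<le> R + 1" "dist y x < d"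
        using r x d(1) norm_triangle_ineq[of "y - x" x] by (auto simp: dist_norm)
      then have "\<bar>c y - c x\<bar> \<le> \<delta>"
        using d(2)[of x y] x by (simp add: dist_real_def)
      then show ?thesis by (simp add: abs_mult ker0_nonneg mult_right_mono)
    qed (simp add: supp)
    have "(\<integral>y. c y * ker0 r (x - y) \<partial>lborel) - c x * (\<integral>y. ker0 r (x - y) \<partial>lborel)
        = (\<integral>y. (c y - c x) * ker0 r (x - y) \<partial>lborel)"
      using I[OF c] I1 by (simp add: left_diff_distrib)
    also have "\<bar>\<dots>\<bar> \<le> (\<integral>y. \<delta> * ker0 r (x - y) \<partial>lborel)"
      using near I1 by (intro integral_abs_le I continuous_intros c) auto
    finally show "\<bar>(\<integral>y. c y * ker0 r (x - y) \<partial>lborel) - c x * (\<integral>z. ker0 r (z::'a) \<partial>lborel)\<bar>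
        \<le> \<delta> * (\<integral>z. ker0 r (z::'a) \<partial>lborel)"
      unfolding m by simp
  qed (use d in auto)
qed

section \<open>Removing the mollification and the cutoff\<close>

lemma integrable_mult_continuous:
  fixes a g :: "'a::euclidean_space \<Rightarrow> real"
  assumes a: "integrable lborel a" "\<And>x. norm x > R \<Longrightarrow> a x = 0" and g: "continuous_on UNIV g"
  shows "integrable lborel (\<lambda>x. a x * g x)"
proof -
  have "bounded (g ` cball 0 R)"
    using g by (intro compact_imp_bounded compact_continuous_image) (auto intro: continuous_on_subset)
  then obtain M where M: "\<And>x. x \<in> cball 0 R \<Longrightarrow> \<bar>g x\<bar> \<le> M"
    unfolding bounded_iff by force
  have [measurable]: "g \<in> borel_measurable borel" "a \<in> borel_measurable borel"
    using g borel_measurable_integrable[OF a(1)] by (auto intro: borel_measurable_continuous_onI)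
  have "integrable lborel (\<lambda>x. M * a x)" using a(1) by simp
  then show ?thesis
  proof (rule Bochner_Integration.integrable_bound)
    have "norm (a x * g x) \<le> norm (M * a x)" for x
    proof (cases "norm x > R")
      case False
      then have "\<bar>g x\<bar> \<le> \<bar>M\<bar>" using M[of x] by simp
      then show ?thesis by (simp add: abs_mult mult.commute[of "\<bar>M\<bar>"] mult_left_mono)
    qed (simp add: a(2))
    then show "AE x in lborel. norm (a x * g x) \<le> norm (M * a x)" by simp
  qed simp
qed

text \<open>In the mollified estimate, both convolutions are replaced by the mass of the kernel
  times the unmollified function. Since \<open>a\<close> and \<open>H\<close> vanish outside one
  ball, closeness on that ball is enough and the errors are controlled by the norms of
  \<open>a\<close> and \<open>H\<close> in \<open>L^1\<close>. Dividing by the mass leaves an error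
  linear in \<open>\<delta>\<close>.\<close>

lemma weak_solution_estimate:
  fixes V u w a :: "'a::euclidean_space \<Rightarrow> real" and H :: "'a \<Rightarrow> 'a"
  assumes V: "C_k 1 V"
    and u: "L-lipschitz_on UNIV u"
    and w: "continuous_on UNIV w"
    and sol: "weak_solution V u w"
    and aH: "weak_grad a H"
    and supp: "\<And>x. norm x > R \<Longrightarrow> a x = 0" "\<And>x. norm x > R \<Longrightarrow> H x = 0"
  shows "\<bar>\<integral>x. a x * (w x * exp (- V x)) \<partial>lborel\<bar> \<le> L * (\<integral>x. norm (H x) * exp (- V x) \<partial>lborel)"
proof -
  define P where "P y = exp (- V y)" for y
  define Q where "Q y = w y * P y" for y
  have Vc: "continuous_on UNIV V"
    using C_k_mono[OF V, of 0] by (simp add: C_k_0)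
  then have Pc: "continuous_on UNIV P" and Qc: "continuous_on UNIV Q"
    unfolding P_def[abs_def] Q_def[abs_def] using w by (auto intro!: continuous_intros)
  have "set_integrable lborel (cball 0 R) a" "set_integrable lborel (cball 0 R) H"
    using aH by (auto simp: weak_grad_def)
  moreover have "(\<lambda>x. indicator (cball 0 R) x *\<^sub>R a x) = a" "(\<lambda>x. indicator (cball 0 R) x *\<^sub>R H x) = H"
    using supp by (force simp: indicator_def)+
  ultimately have ai: "integrable lborel a" and Hi: "integrable lborel H"
    by (simp_all add: set_integrable_def)
  have L: "L \<ge> 0" using u by (rule lipschitz_on_nonneg)
  let ?A = "\<integral>x. \<bar>a x\<bar> \<partial>lborel" and ?H = "\<integral>x. norm (H x) \<partial>lborel"
  let ?B = "\<integral>x. norm (H x) * P x \<partial>lborel"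
  have "\<bar>\<integral>x. a x * Q x \<partial>lborel\<bar> \<le> L * ?B + \<delta> * (?A + L * ?H)" if \<delta>: "\<delta> > 0" for \<delta>
  proof -
    obtain r1 where r1: "r1 > 0" "\<And>r x. 0 < r \<Longrightarrow> r \<le> r1 \<Longrightarrow> norm x \<le> R \<Longrightarrow>
      \<bar>(\<integral>y. Q y * ker0 r (x - y) \<partial>lborel) - Q x * (\<integral>z. ker0 r (z::'a) \<partial>lborel)\<bar> \<le> \<delta> * (\<integral>z. ker0 r (z::'a) \<partial>lborel)"
      using mollification_close[OF Qc \<delta>, of R] by blast
    obtain r2 where r2: "r2 > 0" "\<And>r x. 0 < r \<Longrightarrow> r \<le> r2 \<Longrightarrow> norm x \<le> R \<Longrightarrow>
      \<bar>(\<integral>y. P y * ker0 r (x - y) \<partial>lborel) - P x * (\<integral>z. ker0 r (z::'a) \<partial>lborel)\<bar> \<le> \<delta> * (\<integral>z. ker0 r (z::'a) \<partial>lborel)"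
      using mollification_close[OF Pc \<delta>, of R] by blast
    define r where "r = min r1 r2"
    have r: "r > 0" using r1 r2 by (simp add: r_def)
    define m where "m = (\<integral>z. ker0 r (z::'a) \<partial>lborel)"
    have m: "m > 0" unfolding m_def by (rule integral_ker0_pos[OF r])
    define Qr Pr where "Qr x = (\<integral>y. Q y * ker0 r (x - y) \<partial>lborel)"
      and "Pr x = (\<integral>y. P y * ker0 r (x - y) \<partial>lborel)" for x
    have est: "\<bar>\<integral>x. a x * Qr x \<partial>lborel\<bar> \<le> L * (\<integral>x. norm (H x) * Pr x \<partial>lborel)"
      using mollified_estimate[OF V u w sol aH supp ai Hi r] by (simp add: Qr_def Pr_def Q_def P_def)
    have i1: "integrable lborel (\<lambda>x. a x * Qr x)"
      unfolding Qr_def by (rule convolution_Fubini(1)[where R = R and r = r])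
        (use ai supp Qc ker_continuous ker_eq_0[OF r] in auto)
    have i2: "integrable lborel (\<lambda>x. norm (H x) * Pr x)"
      unfolding Pr_def by (rule convolution_Fubini(1)[where R = R and r = r])
        (use Hi supp Pc ker_continuous ker_eq_0[OF r] in auto)
    have i3: "integrable lborel (\<lambda>x. a x * Q x)"
      by (rule integrable_mult_continuous[where R = R]) (use ai supp Qc in auto)
    have i4: "integrable lborel (\<lambda>x. norm (H x) * P x)"
      by (rule integrable_mult_continuous[where R = R]) (use Hi supp Pc in auto)
    have "\<bar>\<integral>x. m * (a x * Q x) - a x * Qr x \<partial>lborel\<bar> \<le> (\<integral>x. \<delta> * m * \<bar>a x\<bar> \<partial>lborel)"
    proof (rule integral_abs_le)
      fix x
      have "m * (a x * Q x) - a x * Qr x = a x * (Q x * m - Qr x)" by (simp add: algebra_simps)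
      moreover have "\<bar>Q x * m - Qr x\<bar> \<le> \<delta> * m" if "norm x \<le> R"
        using r1(2)[OF r _ that] unfolding r_def m_def Qr_def by (simp add: abs_minus_commute)
      ultimately show "\<bar>m * (a x * Q x) - a x * Qr x\<bar> \<le> \<delta> * m * \<bar>a x\<bar>"
        using supp(1)[of x] by (cases "norm x \<le> R") (auto simp: abs_mult mult.commute intro!: mult_left_mono)
    qed (use i1 i3 ai in auto)
    then have 1: "m * \<bar>\<integral>x. a x * Q x \<partial>lborel\<bar> \<le> \<bar>\<integral>x. a x * Qr x \<partial>lborel\<bar> + m * (\<delta> * ?A)"
      using i1 i3 m abs_triangle_ineq2[of "m * (\<integral>x. a x * Q x \<partial>lborel)" "\<integral>x. a x * Qr x \<partial>lborel"]
      by (simp add: abs_mult mult_ac)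
    have "(\<integral>x. norm (H x) * Pr x \<partial>lborel) \<le> (\<integral>x. m * (norm (H x) * P x) + m * \<delta> * norm (H x) \<partial>lborel)"
    proof (rule integral_mono)
      fix x
      have "Pr x \<le> m * P x + m * \<delta>" if "norm x \<le> R"
        using r2(2)[OF r _ that] unfolding r_def m_def Pr_def by (simp add: abs_le_iff mult_ac)
      then have "norm (H x) * Pr x \<le> norm (H x) * (m * P x + m * \<delta>)"
        using supp(2)[of x] by (cases "norm x \<le> R") (auto intro!: mult_left_mono)
      then show "norm (H x) * Pr x \<le> m * (norm (H x) * P x) + m * \<delta> * norm (H x)"
        by (simp add: algebra_simps)
    qed (use i2 i4 Hi in auto)
    also have "\<dots> = m * (?B + \<delta> * ?H)"
      using i4 Hi by (simp add: algebra_simps)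
    finally have "L * (\<integral>x. norm (H x) * Pr x \<partial>lborel) \<le> L * (m * (?B + \<delta> * ?H))"
      using L by (rule mult_left_mono)
    with 1 est have "m * \<bar>\<integral>x. a x * Q x \<partial>lborel\<bar> \<le> m * (L * ?B + \<delta> * (?A + L * ?H))"
      by (simp add: algebra_simps)
    then show ?thesis using m by (simp add: mult_le_cancel_left)
  qed
  note ineq = this
  have "((\<lambda>\<delta>. L * ?B + \<delta> * (?A + L * ?H)) \<longlongrightarrow> L * ?B + 0 * (?A + L * ?H)) (at_right 0)"
    by (intro tendsto_intros)
  moreover have "eventually (\<lambda>\<delta>. \<bar>\<integral>x. a x * Q x \<partial>lborel\<bar> \<le> L * ?B + \<delta> * (?A + L * ?H)) (at_right 0)"
    using ineq by (auto simp: eventually_at_filter)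
  ultimately have "\<bar>\<integral>x. a x * Q x \<partial>lborel\<bar> \<le> L * ?B + 0 * (?A + L * ?H)"
    by (rule tendsto_lowerbound) simp
  then show ?thesis by (simp add: Q_def P_def)
qed

section \<open>Cutoffs with small gradient and functions of unbounded support\<close>

text \<open>One bump is rescaled to radius \<open>n + 1\<close>, so its gradient shrinks like the
  inverse radius. The factor \<open>exp 1\<close> normalises the value at the centre, which is
  \<open>exp (- 1)\<close>; pointwise convergence to 1 is continuity of \<open>flat_exp 1\<close> at
  1.\<close>

lemma cutoff_functions:
  obtains \<eta> :: "nat \<Rightarrow> 'a::euclidean_space \<Rightarrow> real" and D
  where "D \<ge> 0" "\<And>n. test_fun (\<eta> n)" "\<And>n x. 0 \<le> \<eta> n x" "\<And>n x. \<eta> n x \<le> 1"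
    "\<And>x. (\<lambda>n. \<eta> n x) \<longlonglongrightarrow> 1" "\<And>n x. norm (grad (\<eta> n) x) \<le> D / real (Suc n)"
proof -
  define \<eta> :: "nat \<Rightarrow> 'a \<Rightarrow> real" where "\<eta> n x = exp 1 * bump 1 1 (1 / (real (Suc n))\<^sup>2) 0 x" for n x
  obtain M where M: "M \<ge> 0" "\<And>t. t \<le> 1 \<Longrightarrow> \<bar>flat_exp (flat_exp_deriv 1) t\<bar> \<le> M"
    using flat_exp_bounded by blast
  show ?thesis
  \<comment> \<open>The 2 comes from differentiating the squared norm, \<open>exp 1\<close> from the
    normalisation and \<open>M\<close> from the bound on the derivative of the profile.\<close>
  proof (rule that[of "2 * exp 1 * M" \<eta>])
    show "test_fun (\<eta> n)" for n
    proof -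
      have "norm x \<le> real (Suc n)" if "\<eta> n x \<noteq> 0" for x
        using that bump_eq_0(2)[of "real (Suc n)" x 0 1] by (force simp: \<eta>_def)
      then have "bounded {x. \<eta> n x \<noteq> 0}" unfolding bounded_iff by blast
      moreover have "smooth_fun (\<eta> n)"
        unfolding \<eta>_def by (intro smooth_fun_mult smooth_fun_const smooth_fun_bump)
      ultimately show ?thesis by (simp add: test_fun_def)
    qed
    show "0 \<le> \<eta> n x" for n x
      by (simp add: \<eta>_def bump_def flat_exp_def)
    show "\<eta> n x \<le> 1" for n x
    proof -
      define t where "t = 1 - 1 / (real (Suc n))\<^sup>2 * (x \<bullet> x)"
      have "t \<le> 1" by (simp add: t_def)
      then have "flat_exp 1 t \<le> exp (- 1)"
        by (auto simp: flat_exp_def field_simps)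
      then show ?thesis
        by (simp add: \<eta>_def bump_def t_def exp_minus field_simps)
    qed
    show "(\<lambda>n. \<eta> n x) \<longlonglongrightarrow> 1" for x
    proof -
      have "(\<lambda>n. 1 - (inverse (real (Suc n)))\<^sup>2 * (x \<bullet> x)) \<longlonglongrightarrow> 1 - 0\<^sup>2 * (x \<bullet> x)"
        by (intro tendsto_intros LIMSEQ_inverse_real_of_nat)
      then have "(\<lambda>n. exp 1 * flat_exp 1 (1 - (inverse (real (Suc n)))\<^sup>2 * (x \<bullet> x))) \<longlonglongrightarrow> exp 1 * flat_exp 1 1"
        by (intro tendsto_mult tendsto_const isCont_tendsto_compose[OF DERIV_isCont[OF flat_exp_has_real_derivative]]) simp
      then show ?thesis
        by (simp add: \<eta>_def bump_def flat_exp_def[of _ 1] field_simps flip: exp_add)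
    qed
    show "norm (grad (\<eta> n) x) \<le> 2 * exp 1 * M / real (Suc n)" for n x
    proof -
      define N where "N = real (Suc n)"
      have N: "N > 0" by (simp add: N_def)
      define c where "c = exp 1 * (bump (flat_exp_deriv 1) 1 (1 / N\<^sup>2) 0 x * (- 2 * (1 / N\<^sup>2)))"
      have "(\<eta> n has_derivative (\<lambda>v. exp 1 * (bump (flat_exp_deriv 1) 1 (1 / N\<^sup>2) 0 x * (- 2 * (1 / N\<^sup>2) * ((x - 0) \<bullet> v))))) (at x)" for x
        unfolding \<eta>_def N_def by (intro has_derivative_mult_right bump_has_derivative)
      from dderiv_eqI[OF this] have "grad (\<eta> n) x = (\<Sum>b\<in>Basis. (c * (x \<bullet> b)) *\<^sub>R b)"
        by (simp add: grad_def c_def mult_ac del: dderiv.simps)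
      also have "\<dots> = c *\<^sub>R x"
        by (subst (2) euclidean_representation[of x, symmetric]) (simp add: scaleR_sum_right)
      finally have eq: "grad (\<eta> n) x = c *\<^sub>R x" .
      show ?thesis
      \<comment> \<open>Outside the ball the coefficient \<open>c\<close> vanishes. Inside, it is of
        order \<open>1 / N\<^sup>2\<close> and \<open>norm x < N\<close> gives back one power of
        \<open>N\<close>.\<close>
      proof (cases "norm x \<ge> N")
        case True
        then show ?thesis
          using bump_eq_0(2)[OF N, of x 0] M(1) by (simp add: eq c_def)
      next
        case False
        have "\<bar>bump (flat_exp_deriv 1) 1 (1 / N\<^sup>2) 0 x\<bar> \<le> M"
          unfolding bump_def by (rule M(2)) simp
        then have "\<bar>c\<bar> \<le> 2 * exp 1 * M / N\<^sup>2"
          using N by (simp add: c_def abs_mult divide_right_mono)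
        then have "\<bar>c\<bar> * norm x \<le> 2 * exp 1 * M / N\<^sup>2 * N"
          using False M by (intro mult_mono) auto
        then show ?thesis
          using N unfolding eq N_def[symmetric] by (simp add: power2_eq_square)
      qed
    qed
  qed (use M in auto)
qed

text \<open>\<open>weak_grad\<close> speaks of \<open>G\<close> on compact sets only, so
  measurability is recovered by writing \<open>G\<close> as the pointwise limit of its restrictions
  to growing balls.\<close>

lemma weak_grad_borel_measurable:
  fixes f :: "'a::euclidean_space \<Rightarrow> real"
  assumes "weak_grad f G"
  shows "G \<in> borel_measurable borel"
proof (rule borel_measurable_LIMSEQ_metric)
  fix n :: nat
  have "integrable lborel (\<lambda>x. indicator (cball 0 (real n)) x *\<^sub>R G x)"
    using assms by (auto simp: weak_grad_def set_integrable_def)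
  from borel_measurable_integrable[OF this]
  show "(\<lambda>x. indicator (cball 0 (real n)) x *\<^sub>R G x) \<in> borel_measurable borel" by simp
next
  fix x :: 'a
  obtain k :: nat where "norm x \<le> real k" using real_arch_simple by blast
  then have "eventually (\<lambda>n. G x = indicator (cball 0 (real n)) x *\<^sub>R G x) sequentially"
    by (intro eventually_sequentiallyI[of k]) (auto simp: indicator_def)
  then show "(\<lambda>n. indicator (cball 0 (real n)) x *\<^sub>R G x) \<longlonglongrightarrow> G x"
    by (rule Lim_transform_eventually[OF tendsto_const])
qed

text \<open>The compactly supported estimate is applied to \<open>\<eta> n x * f x\<close>. Its weak
  gradient has the extra term \<open>f x *\<^sub>R grad (\<eta> n) x\<close>, whose integral is at
  most \<open>D / (n + 1)\<close> times that of \<open>\<bar>f\<bar>\<close> and so disappears in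
  the limit, as \<open>f\<close> is integrable for \<open>mu V\<close>. The pairing converges by
  domination.\<close>

lemma weak_solution_pairing_le:
  fixes V u w f :: "'a::euclidean_space \<Rightarrow> real" and G :: "'a \<Rightarrow> 'a"
  assumes V: "C_k 1 V"
    and u: "L-lipschitz_on UNIV u"
    and w: "continuous_on UNIV w"
    and sol: "weak_solution V u w"
    and fG: "weak_grad f G"
    and f: "f \<in> borel_measurable borel" "integrable (mu V) f"
    and fw: "integrable (mu V) (\<lambda>x. f x * w x)"
    and G: "integrable (mu V) (\<lambda>x. norm (G x))"
  shows "\<bar>\<integral>x. f x * w x \<partial>mu V\<bar> \<le> L * (\<integral>x. norm (G x) \<partial>mu V)"
proof -
  have Vc: "continuous_on UNIV V"
    using C_k_mono[OF V, of 0] by (simp add: C_k_0)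
  have Gm [measurable]: "G \<in> borel_measurable borel" by (rule weak_grad_borel_measurable[OF fG])
  have [measurable]: "w \<in> borel_measurable borel" "V \<in> borel_measurable borel" "f \<in> borel_measurable borel"
    using w Vc f by (auto intro: borel_measurable_continuous_onI)
  have fi: "integrable lborel (\<lambda>x. f x * exp (- V x))"
    and fwi: "integrable lborel (\<lambda>x. f x * w x * exp (- V x))"
    and Gi: "integrable lborel (\<lambda>x. norm (G x) * exp (- V x))"
    using f fw G integrable_mu[OF Vc] by simp_all
  have L: "L \<ge> 0" using u by (rule lipschitz_on_nonneg)
  obtain \<eta> :: "nat \<Rightarrow> 'a \<Rightarrow> real" and D
    where \<eta>: "D \<ge> 0" "\<And>n. test_fun (\<eta> n)" "\<And>n x. 0 \<le> \<eta> n x" "\<And>n x. \<eta> n x \<le> 1"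
    "\<And>x. (\<lambda>n. \<eta> n x) \<longlonglongrightarrow> 1" "\<And>n x. norm (grad (\<eta> n) x) \<le> D / real (Suc n)"
    using cutoff_functions by metis
  have sm: "smooth_fun (\<eta> n)" for n using \<eta>(2) by (simp add: test_fun_def)
  have [measurable]: "\<eta> n \<in> borel_measurable borel" "grad (\<eta> n) \<in> borel_measurable borel" for n
    using smooth_fun_dderiv(1)[OF sm, of UNIV n "[]"] grad_continuous[OF sm, of UNIV n]
    by (auto intro: borel_measurable_continuous_onI)
  let ?F = "\<integral>x. \<bar>f x\<bar> * exp (- V x) \<partial>lborel" and ?G = "\<integral>x. norm (G x) * exp (- V x) \<partial>lborel"
  have absf: "integrable lborel (\<lambda>x. \<bar>f x\<bar> * exp (- V x))"
    using integrable_abs[OF fi] by (simp add: abs_mult)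
  have est: "\<bar>\<integral>x. \<eta> n x * (f x * w x * exp (- V x)) \<partial>lborel\<bar> \<le> L * (?G + inverse (real (Suc n)) * (D * ?F))" for n
  proof -
    define H where "H x = \<eta> n x *\<^sub>R G x + f x *\<^sub>R grad (\<eta> n) x" for x
    have [measurable]: "H \<in> borel_measurable borel" unfolding H_def by measurable
    obtain R where R: "\<And>x. norm x > R \<Longrightarrow> \<eta> n x = 0" "\<And>x v. norm x > R \<Longrightarrow> dderiv (\<eta> n) [v] x = 0"
      using test_fun_support[OF \<eta>(2)] by blast
    have gR: "norm x > R \<Longrightarrow> grad (\<eta> n) x = 0" for x
      using R(2) by (simp add: grad_def del: dderiv.simps)
    have "\<bar>\<integral>x. (\<eta> n x * f x) * (w x * exp (- V x)) \<partial>lborel\<bar> \<le> L * (\<integral>x. norm (H x) * exp (- V x) \<partial>lborel)"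
      by (rule weak_solution_estimate[OF V u w sol, where R = R])
         (use weak_grad_mult[OF fG \<eta>(2)] R gR in \<open>auto simp: H_def\<close>)
    also have "\<dots> \<le> L * (\<integral>x. norm (G x) * exp (- V x) + inverse (real (Suc n)) * D * (\<bar>f x\<bar> * exp (- V x)) \<partial>lborel)"
    proof (intro mult_left_mono L integral_mono_AE)
      have b: "norm (H x) * exp (- V x) \<le> norm (G x) * exp (- V x) + inverse (real (Suc n)) * D * (\<bar>f x\<bar> * exp (- V x))" for x
      proof -
        have "norm (H x) \<le> \<eta> n x * norm (G x) + \<bar>f x\<bar> * norm (grad (\<eta> n) x)"
          unfolding H_def using \<eta>(3)[of n x] by (intro order_trans[OF norm_triangle_ineq]) simp
        also have "\<dots> \<le> 1 * norm (G x) + \<bar>f x\<bar> * (D / real (Suc n))"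
          using \<eta>(4,6)[of n x] by (intro add_mono mult_right_mono mult_left_mono) auto
        finally have "norm (H x) * exp (- V x) \<le> (1 * norm (G x) + \<bar>f x\<bar> * (D / real (Suc n))) * exp (- V x)"
          by (rule mult_right_mono) simp
        then show ?thesis by (simp add: algebra_simps divide_inverse)
      qed
      show int: "integrable lborel (\<lambda>x. norm (G x) * exp (- V x) + inverse (real (Suc n)) * D * (\<bar>f x\<bar> * exp (- V x)))"
        using Gi absf by (intro Bochner_Integration.integrable_add integrable_mult_right)
      show "integrable lborel (\<lambda>x. norm (H x) * exp (- V x))"
        by (rule Bochner_Integration.integrable_bound[OF int]) (use b in \<open>auto intro: order_trans[OF _ abs_ge_self]\<close>)
      show "AE x in lborel. norm (H x) * exp (- V x) \<le> norm (G x) * exp (- V x) + inverse (real (Suc n)) * D * (\<bar>f x\<bar> * exp (- V x))"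
        using b by simp
    qed
    also have "\<dots> = L * (?G + inverse (real (Suc n)) * (D * ?F))"
      using Gi absf by (simp add: mult.assoc)
    finally show ?thesis by (simp add: mult.assoc)
  qed
  have "(\<lambda>n. \<integral>x. \<eta> n x * (f x * w x * exp (- V x)) \<partial>lborel) \<longlonglongrightarrow> (\<integral>x. f x * w x * exp (- V x) \<partial>lborel)"
  proof (rule integral_dominated_convergence[where w = "\<lambda>x. \<bar>f x * w x * exp (- V x)\<bar>"])
    show "AE x in lborel. (\<lambda>n. \<eta> n x * (f x * w x * exp (- V x))) \<longlonglongrightarrow> f x * w x * exp (- V x)"
      using tendsto_mult[OF \<eta>(5) tendsto_const] by fastforce
    show "AE x in lborel. norm (\<eta> n x * (f x * w x * exp (- V x))) \<le> \<bar>f x * w x * exp (- V x)\<bar>" for n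
      unfolding real_norm_def abs_mult[of "\<eta> n _"]
      using \<eta>(3,4) by (intro AE_I2 mult_left_le_one_le) auto
    show "integrable lborel (\<lambda>x. \<bar>f x * w x * exp (- V x)\<bar>)" using fwi by (rule integrable_abs)
  qed measurable
  moreover have "(\<lambda>n. L * (?G + inverse (real (Suc n)) * (D * ?F))) \<longlonglongrightarrow> L * (?G + 0 * (D * ?F))"
    by (intro tendsto_intros LIMSEQ_inverse_real_of_nat)
  ultimately have "\<bar>\<integral>x. f x * w x * exp (- V x) \<partial>lborel\<bar> \<le> L * (?G + 0 * (D * ?F))"
    using est by (intro LIMSEQ_le[OF tendsto_rabs]) auto
  then show ?thesis
    by (simp add: integral_mu[OF Vc])
qed

section \<open>Kantorovich duality and the transport bound\<close>

theorem theorem2: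
  fixes V :: "'a::euclidean_space \<Rightarrow> real" and C :: real
    and f :: "'a \<Rightarrow> real" and G :: "'a \<Rightarrow> 'a"
  assumes "C_k 2 V"
    and "prob_space (mu V)"
    and "C > 0"
    and "Lip_Lip_const V C"
    and "\<And>x. f x \<ge> 0"
    and "f \<in> borel_measurable borel"
    and "weak_grad f G"
    and "(\<integral>\<^sup>+x. ennreal (f x) \<partial>mu V) = 1"
  shows "W1 (mu V) (density (mu V) (\<lambda>x. ennreal (f x)))
           \<le> ereal C * enn2ereal (\<integral>\<^sup>+x. ennreal (norm (G x)) \<partial>mu V)"
proof (cases "(\<integral>\<^sup>+x. ennreal (norm (G x)) \<partial>mu V) = \<infinity>")
  case True
  \<comment> \<open>A positive constant times infinity is infinity, so the bound is trivial
    here.\<close>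
  then show ?thesis using \<open>C > 0\<close> by simp
next
  case False
  interpret prob_space "mu V" by fact
  have V: "C_k 1 V" using C_k_mono[OF assms(1)] by simp
  have [simp]: "sets (mu V) = sets borel" "space (mu V) = UNIV" by (auto simp: mu_def)
  have fm: "f \<in> borel_measurable (mu V)" using assms(6) by (simp cong: measurable_cong_sets)
  have Gm: "(\<lambda>x. norm (G x)) \<in> borel_measurable (mu V)"
    using weak_grad_borel_measurable[OF assms(7)] by (simp cong: measurable_cong_sets)
  have Gi: "integrable (mu V) (\<lambda>x. norm (G x))"
    using False Gm by (intro integrableI_bounded) (auto simp: top.not_eq_extremum)
  have fi: "integrable (mu V) f" and f1: "(\<integral>x. f x \<partial>mu V) = 1"
    using nn_integral_eq_integrable[of f "mu V" 1] fm assms(5,8) by auto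
  have "ereal ((\<integral>x. h x \<partial>mu V) - (\<integral>x. h x \<partial>density (mu V) (\<lambda>x. ennreal (f x))))
      \<le> ereal C * enn2ereal (\<integral>\<^sup>+x. ennreal (norm (G x)) \<partial>mu V)"
    if h: "1-lipschitz_on UNIV h" and hi: "integrable (mu V) h"
      and hfi: "integrable (density (mu V) (\<lambda>x. ennreal (f x))) h" for h
  proof -
    define m where "m = (\<integral>x. h x \<partial>mu V)"
    obtain u where u: "(C * 1)-lipschitz_on UNIV u" "weak_solution V u (\<lambda>x. h x - m)"
      using assms(4) h hi unfolding Lip_Lip_const_def m_def by blast
    have hc: "continuous_on UNIV h" using h by (rule lipschitz_on_continuous_on)
    have hm: "h \<in> borel_measurable (mu V)" using hi by (rule borel_measurable_integrable)
    \<comment> \<open>Integrability of \<open>h\<close> for both measures is part of the competitor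
      class of \<open>W1\<close>; it makes the pairing of \<open>f\<close> with \<open>h - m\<close>
      well defined.\<close>
    have hfi': "integrable (mu V) (\<lambda>x. f x * h x)"
      using hfi integrable_density[OF hm fm] assms(5) by simp
    have hf: "(\<integral>x. h x \<partial>density (mu V) (\<lambda>x. ennreal (f x))) = (\<integral>x. f x * h x \<partial>mu V)"
      using integral_density[OF hm fm] assms(5) by simp
    have fwi: "integrable (mu V) (\<lambda>x. f x * (h x - m))"
      using hfi' fi by (simp add: right_diff_distrib)
    \<comment> \<open>Since \<open>f\<close> has total mass 1, the constant \<open>m\<close>
      integrates to itself, and the pairing is exactly minus the difference of integrals in
      \<open>W1\<close>.\<close>
    have "(\<integral>x. f x * (h x - m) \<partial>mu V) = (\<integral>x. f x * h x \<partial>mu V) - m"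
      using hfi' fi f1 by (simp add: right_diff_distrib)
    moreover have "\<bar>\<integral>x. f x * (h x - m) \<partial>mu V\<bar> \<le> (C * 1) * (\<integral>x. norm (G x) \<partial>mu V)"
      using hc by (intro weak_solution_pairing_le[OF V u(1) _ u(2) assms(7,6) fi fwi Gi] continuous_intros)
    ultimately have "(\<integral>x. h x \<partial>mu V) - (\<integral>x. h x \<partial>density (mu V) (\<lambda>x. ennreal (f x)))
        \<le> C * (\<integral>x. norm (G x) \<partial>mu V)"
      unfolding hf m_def[symmetric] by linarith
    moreover have "(\<integral>\<^sup>+x. ennreal (norm (G x)) \<partial>mu V) = ennreal (\<integral>x. norm (G x) \<partial>mu V)"
      using Gi by (intro nn_integral_eq_integral) auto
    ultimately show ?thesis
      by (simp add: enn2ereal_ennreal)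
  qed
  then show ?thesis
    unfolding W1_def by (intro Sup_least) blast
qed

end
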